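(* Let $\mathcal{H}$ be the class of graphs consisting of all complete multipartite graphs, all even cycles, and all paths. Let $F$ be a bipartite graph and let $H$ be an $\mathcal{H}$-blow-up of $F$. Then for every integer $q\ge 2$, \[ \hom(H,K_q)^2\le \hom(H\times K_2,K_q). \]
   Context: $\hom(H,G)$ denotes the number of graph homomorphisms from $H$ to $G$ (vertex maps sending edges to edges); $K_q$ is the loopless complete graph on $q$ vertices, so $\hom(H,K_q)$ is the number of proper $q$-colourings of $H$. The tensor product $H\times K_2$ has vertex set $V(H)\times\{1,2\}$, with $(u,i)$ adjacent to $(v,j)$ iff $uv\in E(H)$ and $i\neq j$. For a class $\mathcal{H}$ of graphs and a graph $F$ on vertices $v_1,\dots,v_k$, an $\mathcal{H}$-blow-up of $F$ is obtained by choosing $H_1,\dots,H_k\in\mathcal{H}$, taking the disjoint union of $H_1,\dots,H_k$ (replacing $v_i$ by $H_i$), and adding all edges between $V(H_i)$ and $V(H_j)$ (a complete bipartite graph $K_{|V(H_i)|,|V(H_j)|}$) whenever $v_iv_j\in E(F)$. Complete $1$-partite graphs are edgeless graphs, so in particular $K_1$ belongs to $\mathcal{H}$. *)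

theory Defs
  imports "HOL-Library.FuncSet"
begin

record 'a graph =
  verts :: "'a set"
  edges :: "('a \<times> 'a) set"

definition wf_graph :: "('a, 'b) graph_scheme \<Rightarrow> bool" where
  "wf_graph G \<longleftrightarrow> finite (verts G) \<and> edges G \<subseteq> verts G \<times> verts G
     \<and> sym (edges G) \<and> irrefl (edges G)"

definition hom :: "'a graph \<Rightarrow> 'b graph \<Rightarrow> nat" where
  "hom H G = card {f. f \<in> verts H \<rightarrow>\<^sub>E verts G \<and>
                      (\<forall>(u, v) \<in> edges H. (f u, f v) \<in> edges G)}"

definition complete_graph :: "nat \<Rightarrow> nat graph" where
  "complete_graph q = \<lparr>verts = {0..<q}, edges = {(i, j). i < q \<and> j < q \<and> i \<noteq> j}\<rparr>"

definition tensor_K2 :: "'a graph \<Rightarrow> ('a \<times> nat) graph" where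
  "tensor_K2 H = \<lparr>verts = verts H \<times> {1, 2},
     edges = {((u, i), (v, j)). (u, v) \<in> edges H \<and> i \<in> {1, 2} \<and> j \<in> {1, 2} \<and> i \<noteq> j}\<rparr>"

definition bipartite :: "'a graph \<Rightarrow> bool" where
  "bipartite F \<longleftrightarrow> (\<exists>c :: 'a \<Rightarrow> bool. \<forall>(u, v) \<in> edges F. c u \<noteq> c v)"

text \<open>Complete multipartite graphs (at least one part; one part = edgeless graph).\<close>
definition complete_multipartite :: "'a graph \<Rightarrow> bool" where
  "complete_multipartite H \<longleftrightarrow> verts H \<noteq> {} \<and>
     (\<exists>c :: 'a \<Rightarrow> nat. edges H = {(u, v). u \<in> verts H \<and> v \<in> verts H \<and> c u \<noteq> c v})"

definition is_path :: "'a graph \<Rightarrow> bool" where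
  "is_path H \<longleftrightarrow> (\<exists>(n::nat) p. n \<ge> 1 \<and> bij_betw p {0..<n} (verts H) \<and>
     edges H = {(p i, p j) | i j. i < n \<and> j < n \<and> (j = i + 1 \<or> i = j + 1)})"

definition is_even_cycle :: "'a graph \<Rightarrow> bool" where
  "is_even_cycle H \<longleftrightarrow> (\<exists>(n::nat) p. n \<ge> 4 \<and> even n \<and> bij_betw p {0..<n} (verts H) \<and>
     edges H = {(p i, p j) | i j. i < n \<and> j < n \<and> (j = (i + 1) mod n \<or> i = (j + 1) mod n)})"

definition class_H :: "'a graph \<Rightarrow> bool" where
  "class_H H \<longleftrightarrow> complete_multipartite H \<or> is_even_cycle H \<or> is_path H"

definition blow_up :: "'b graph \<Rightarrow> ('b \<Rightarrow> 'a graph) \<Rightarrow> ('b \<times> 'a) graph" where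
  "blow_up F Hs = \<lparr>verts = Sigma (verts F) (\<lambda>i. verts (Hs i)),
     edges = {((i, x), (j, y)). i \<in> verts F \<and> j \<in> verts F \<and> x \<in> verts (Hs i) \<and> y \<in> verts (Hs j) \<and>
                ((i = j \<and> (x, y) \<in> edges (Hs i)) \<or> (i, j) \<in> edges F)}\<rparr>"

end

theory Submission
  imports Defs
begin

text \<open>
  A colouring of \<open>H \<times> K\<^sub>2\<close> is a pair of colourings \<open>(f, g)\<close> of \<open>H\<close> with \<open>f u \<noteq> g v\<close> on every edge.
  Swapping \<open>f\<close> and \<open>g\<close> on one side of the bipartition of \<open>F\<close> turns this condition into properness of
  \<open>f\<close> and of \<open>g\<close> for the edges joining different blobs, and does not affect it inside a blob.
  So one can pass from pairs of proper colourings to colourings of the double cover one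
  blob at a time. With everything outside the blob fixed, \<open>f\<close> and \<open>g\<close> range over two colour lists
  \<open>X\<close> and \<open>Y\<close>, and it suffices that the number of proper \<open>X\<close>-colourings of the blob times the number
  of its proper \<open>Y\<close>-colourings is at most the number of its \<open>(X, Y)\<close>-coloured double covers.
  Relabelling colours only decreases the latter, so one may assume \<open>X \<subseteq> Y\<close>. Paths are coloured
  greedily; complete multipartite graphs part by part, where enlarging the list from which a part is
  coloured makes it use more colours but a smaller share of a fixed list; for even cycles both
  sides are computed exactly.
\<close>

subsection \<open>Pairs of colour lists\<close>

definition colourings :: "'a graph \<Rightarrow> 'c set \<Rightarrow> ('a \<Rightarrow> 'c) set" where
  "colourings H X = {f \<in> verts H \<rightarrow>\<^sub>E X. \<forall>(u, v) \<in> edges H. f u \<noteq> f v}"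

text \<open>With \<open>edges H\<close> symmetric, the single condition also gives
  \<open>f v \<noteq> g u\<close>. So a pair is a proper colouring of the double cover, with list
  \<open>X\<close> on the copy coloured by \<open>f\<close> and list \<open>Y\<close> on the
  other.\<close>

definition cover_colourings :: "'a graph \<Rightarrow> 'c set \<Rightarrow> 'c set \<Rightarrow> (('a \<Rightarrow> 'c) \<times> ('a \<Rightarrow> 'c)) set" where
  "cover_colourings H X Y = {(f, g). f \<in> verts H \<rightarrow>\<^sub>E X \<and> g \<in> verts H \<rightarrow>\<^sub>E Y \<and>
     (\<forall>(u, v) \<in> edges H. f u \<noteq> g v)}"

text \<open>Two lists occur because \<open>f\<close> and \<open>g\<close> leave different colours
  free around a blob; each is constant on the blob, whose vertices share all their outside
  neighbours. The colour type is fixed because a definition cannot quantify over types.\<close>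

definition list_swappable :: "'a graph \<Rightarrow> bool" where
  "list_swappable H \<longleftrightarrow> (\<forall>X Y :: nat set. finite X \<longrightarrow> finite Y \<longrightarrow>
     card (colourings H X) * card (colourings H Y) \<le> card (cover_colourings H X Y))"

section \<open>Effect of changing the lists or the labels of the vertices\<close>

lemma finite_colourings: "finite (verts H) \<Longrightarrow> finite X \<Longrightarrow> finite (colourings H X)"
  by (rule finite_subset[of _ "verts H \<rightarrow>\<^sub>E X"]) (auto simp: colourings_def intro!: finite_PiE)

lemma finite_cover_colourings:
  assumes "finite (verts H)" "finite X" "finite Y"
  shows "finite (cover_colourings H X Y)"
proof (rule finite_subset)
  show "cover_colourings H X Y \<subseteq> (verts H \<rightarrow>\<^sub>E X) \<times> (verts H \<rightarrow>\<^sub>E Y)"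
    by (auto simp: cover_colourings_def)
  show "finite ((verts H \<rightarrow>\<^sub>E X) \<times> (verts H \<rightarrow>\<^sub>E Y))"
    using assms by (auto intro!: finite_PiE)
qed

text \<open>Colours are renamed along an injection. Used in both directions for lists of equal size,
  this makes the count a function of \<open>card X\<close> alone.\<close>

lemma colourings_card_mono:
  assumes "edges H \<subseteq> verts H \<times> verts H" "finite (verts H)" "finite X" "finite Y" "card X \<le> card Y"
  shows "card (colourings H X) \<le> card (colourings H Y)"
proof -
  obtain h where h: "h ` X \<subseteq> Y" "inj_on h X"
    using card_le_inj[OF assms(3-5)] by blast
  let ?r = "\<lambda>f. restrict (h \<circ> f) (verts H)"
  have "inj_on ?r (colourings H X)"
  proof (rule inj_onI)
    fix f g assume fg: "f \<in> colourings H X" "g \<in> colourings H X" "?r f = ?r g"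
    have f: "f \<in> verts H \<rightarrow>\<^sub>E X" and g: "g \<in> verts H \<rightarrow>\<^sub>E X"
      using fg by (auto simp: colourings_def)
    show "f = g"
    proof (rule PiE_ext[OF f g])
      fix v assume v: "v \<in> verts H"
      then have "h (f v) = h (g v)" using fun_cong[OF fg(3), of v] by simp
      then show "f v = g v" using h(2) f g v by (auto simp: inj_on_def PiE_iff)
    qed
  qed
  moreover have "?r ` colourings H X \<subseteq> colourings H Y"
  proof clarify
    fix f assume f: "f \<in> colourings H X"
    have m: "f v \<in> X" if "v \<in> verts H" for v using f that by (auto simp: colourings_def)
    have "h (f u) \<noteq> h (f v)" if "(u, v) \<in> edges H" for u v
    proof -
      have "f u \<noteq> f v" "u \<in> verts H" "v \<in> verts H"
        using f that assms(1) by (auto simp: colourings_def)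
      then show ?thesis using m h(2) by (auto simp: inj_on_def)
    qed
    then show "?r f \<in> colourings H Y"
      using h(1) m assms(1) by (fastforce simp: colourings_def)
  qed
  ultimately show ?thesis
    by (rule card_inj_on_le) (simp add: finite_colourings assms)
qed

lemma cover_colourings_swap_card:
  assumes "sym (edges H)" "finite (verts H)" "finite X" "finite Y"
  shows "card (cover_colourings H X Y) \<le> card (cover_colourings H Y X)"
proof (rule card_inj_on_le[of prod.swap])
  show "prod.swap ` cover_colourings H X Y \<subseteq> cover_colourings H Y X"
    using assms(1) by (fastforce simp: cover_colourings_def sym_def)
qed (simp_all add: finite_cover_colourings assms)

text \<open>Renaming the colours of \<open>g\<close> by \<open>h\<close> could produce a clash
  \<open>f u = h (g v)\<close> only at a colour of \<open>X\<close>; there \<open>h\<close> is the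
  identity, so \<open>f u = g v\<close> would have held already.\<close>

lemma cover_colourings_relabel_card:
  assumes "edges H \<subseteq> verts H \<times> verts H" "finite (verts H)" "finite X" "finite Y"
    and h: "h ` Z \<subseteq> Y" "inj_on h Z" and fixX: "\<And>z. z \<in> Z \<Longrightarrow> h z \<in> X \<Longrightarrow> h z = z"
  shows "card (cover_colourings H X Z) \<le> card (cover_colourings H X Y)"
proof (rule card_inj_on_le)
  let ?r = "\<lambda>(f, g). (f, restrict (h \<circ> g) (verts H))"
  show "inj_on ?r (cover_colourings H X Z)"
  proof (rule inj_onI, clarify)
    fix f g f' g' assume fg: "(f, g) \<in> cover_colourings H X Z" "(f', g') \<in> cover_colourings H X Z"
      and e: "restrict (h \<circ> g) (verts H) = restrict (h \<circ> g') (verts H)"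
    have g: "g \<in> verts H \<rightarrow>\<^sub>E Z" and g': "g' \<in> verts H \<rightarrow>\<^sub>E Z"
      using fg by (auto simp: cover_colourings_def)
    show "f = f \<and> g = g'"
    proof (intro conjI refl PiE_ext[OF g g'])
      fix v assume v: "v \<in> verts H"
      then have "h (g v) = h (g' v)" using fun_cong[OF e, of v] by simp
      then show "g v = g' v" using h(2) g g' v by (auto simp: inj_on_def PiE_iff)
    qed
  qed
  show "?r ` cover_colourings H X Z \<subseteq> cover_colourings H X Y"
  proof clarify
    fix f g assume fg: "(f, g) \<in> cover_colourings H X Z"
    have m: "g v \<in> Z" "f v \<in> X" if "v \<in> verts H" for v
      using fg that by (auto simp: cover_colourings_def)
    have "f u \<noteq> h (g v)" if "(u, v) \<in> edges H" for u v
    proof -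
      have "f u \<noteq> g v" "u \<in> verts H" "v \<in> verts H"
        using fg that assms(1) by (auto simp: cover_colourings_def)
      then show ?thesis using m fixX by metis
    qed
    then show "(f, restrict (h \<circ> g) (verts H)) \<in> cover_colourings H X Y"
      using h(1) m assms(1) fg by (fastforce simp: cover_colourings_def)
  qed
qed (simp add: finite_cover_colourings assms)

text \<open>The larger list is replaced by a list of the same size that contains the smaller one.
  The proper colourings keep their number, and the double cover has at least as many colourings with
  the original lists.\<close>

lemma list_swappable_if_nested:
  assumes wf: "wf_graph H"
    and nested: "\<And>X Y :: nat set. finite Y \<Longrightarrow> X \<subseteq> Y \<Longrightarrow>
      card (colourings H X) * card (colourings H Y) \<le> card (cover_colourings H X Y)"
  shows "list_swappable H"
proof -
  have H: "edges H \<subseteq> verts H \<times> verts H" "finite (verts H)" "sym (edges H)"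
    using wf by (auto simp: wf_graph_def)
  have le: "card (colourings H X) * card (colourings H Y) \<le> card (cover_colourings H X Y)"
    if fin: "finite X" "finite Y" and "card X \<le> card Y" for X Y :: "nat set"
  proof -
    have "card (X - Y) \<le> card (Y - X)"
      using fin that(3) by (simp add: card_Diff_subset_Int Int_commute)
    then obtain e where e: "e ` (X - Y) \<subseteq> Y - X" "inj_on e (X - Y)"
      using card_le_inj[of "X - Y" "Y - X"] fin by auto
    define h where "h z = (if z \<in> X - Y then e z else z)" for z
    define Z where "Z = X \<union> (Y - e ` (X - Y))"
    have hZ: "h ` Z \<subseteq> Y" using e(1) by (auto simp: h_def Z_def)
    have inj: "inj_on h Z"
      using e by (auto simp: h_def Z_def inj_on_def split: if_splits)
    have "Y \<subseteq> h ` Z"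
    proof
      fix y assume y: "y \<in> Y"
      show "y \<in> h ` Z"
      proof (cases "y \<in> e ` (X - Y)")
        case True
        then show ?thesis by (auto simp: h_def Z_def)
      next
        case False
        then have "h y = y" "y \<in> Z" using y by (auto simp: h_def Z_def)
        then show ?thesis by (metis imageI)
      qed
    qed
    then have card: "card Z = card Y"
      using hZ inj card_image by (metis subset_antisym)
    have finZ: "finite Z" using fin by (auto simp: Z_def)
    have "card (colourings H Y) \<le> card (colourings H Z)"
      using H fin finZ card by (intro colourings_card_mono) auto
    then have "card (colourings H X) * card (colourings H Y) \<le> card (colourings H X) * card (colourings H Z)"
      by simp
    also have "\<dots> \<le> card (cover_colourings H X Z)"
      by (rule nested) (auto simp: finZ, auto simp: Z_def)
    also have "\<dots> \<le> card (cover_colourings H X Y)"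
      by (rule cover_colourings_relabel_card[OF H(1,2) fin hZ inj])
        (use e in \<open>auto simp: h_def split: if_splits\<close>)
    finally show ?thesis .
  qed
  show ?thesis unfolding list_swappable_def
  proof (intro allI impI)
    fix X Y :: "nat set" assume fin: "finite X" "finite Y"
    show "card (colourings H X) * card (colourings H Y) \<le> card (cover_colourings H X Y)"
    proof (cases "card X \<le> card Y")
      \<comment> \<open>Interchanging the two copies of \<open>H\<close> exchanges the roles of the
        lists.\<close>
      case False
      then have "card (colourings H Y) * card (colourings H X) \<le> card (cover_colourings H Y X)"
        using le fin by simp
      also have "\<dots> \<le> card (cover_colourings H X Y)"
        using H fin by (intro cover_colourings_swap_card) auto
      finally show ?thesis by (simp add: mult.commute)
    qed (use le fin in simp)
  qed
qed

text \<open>One inequality per side suffices: proper colourings are pulled back along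
  \<open>p\<close>, and colourings of the double cover are pulled back along its inverse
  \<open>r\<close>.\<close>

lemma list_swappable_isomorphic:
  assumes p: "bij_betw p (verts H) (verts H')"
    and E: "edges H' = {(p u, p v) | u v. (u, v) \<in> edges H}"
    and wf: "wf_graph H" and H: "list_swappable H"
  shows "list_swappable H'"
  unfolding list_swappable_def
proof (intro allI impI)
  fix X Y :: "nat set" assume fin: "finite X" "finite Y"
  have fV: "finite (verts H)" and sub: "edges H \<subseteq> verts H \<times> verts H"
    using wf by (auto simp: wf_graph_def)
  have fV': "finite (verts H')" using p fV bij_betw_finite by blast
  have im: "p v \<in> verts H'" if "v \<in> verts H" for v using p that by (auto simp: bij_betw_def)
  define r where "r = inv_into (verts H) p"
  have r: "r (p v) = v" if "v \<in> verts H" for v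
    using p that by (auto simp: r_def bij_betw_def)
  have r': "p (r v) = v" "r v \<in> verts H" if "v \<in> verts H'" for v
    using p that by (auto simp: r_def bij_betw_def inv_into_into f_inv_into_f)
  have col: "card (colourings H' Z) \<le> card (colourings H Z)" if Z: "finite Z" for Z :: "nat set"
  proof (rule card_inj_on_le)
    let ?m = "\<lambda>f. restrict (f \<circ> p) (verts H)"
    show "inj_on ?m (colourings H' Z)"
    proof (rule inj_onI)
      fix f g assume fg: "f \<in> colourings H' Z" "g \<in> colourings H' Z" "?m f = ?m g"
      have f: "f \<in> verts H' \<rightarrow>\<^sub>E Z" and g: "g \<in> verts H' \<rightarrow>\<^sub>E Z"
        using fg by (auto simp: colourings_def)
      show "f = g"
      proof (rule PiE_ext[OF f g])
        fix v assume "v \<in> verts H'"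
        then show "f v = g v" using fun_cong[OF fg(3), of "r v"] r' by simp
      qed
    qed
    show "?m ` colourings H' Z \<subseteq> colourings H Z"
      using im sub E by (fastforce simp: colourings_def)
    show "finite (colourings H Z)" by (simp add: finite_colourings fV Z)
  qed
  have cov: "card (cover_colourings H X Y) \<le> card (cover_colourings H' X Y)"
  proof (rule card_inj_on_le)
    let ?m = "\<lambda>f. restrict (f \<circ> r) (verts H')"
    have inj: "f = g" if "f \<in> verts H \<rightarrow>\<^sub>E Z" "g \<in> verts H \<rightarrow>\<^sub>E Z" "?m f = ?m g" for f g and Z :: "nat set"
    proof (rule PiE_ext[OF that(1,2)])
      fix v assume "v \<in> verts H"
      then show "f v = g v" using fun_cong[OF that(3), of "p v"] r im by simp
    qed
    show "inj_on (map_prod ?m ?m) (cover_colourings H X Y)"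
    proof (rule inj_onI, clarify)
      fix f g f' g' assume a: "(f, g) \<in> cover_colourings H X Y" "(f', g') \<in> cover_colourings H X Y"
        and e: "map_prod ?m ?m (f, g) = map_prod ?m ?m (f', g')"
      then have "?m f = ?m f'" "?m g = ?m g'" by auto
      then show "f = f' \<and> g = g'" using a inj by (auto simp only: cover_colourings_def mem_Collect_eq case_prod_conv)
    qed
    show "map_prod ?m ?m ` cover_colourings H X Y \<subseteq> cover_colourings H' X Y"
    proof (rule image_subsetI)
      fix w assume "w \<in> cover_colourings H X Y"
      then obtain f g where w: "w = (f, g)" and a: "(f, g) \<in> cover_colourings H X Y" by (cases w) auto
      have "f (r u') \<noteq> g (r v')" "u' \<in> verts H'" "v' \<in> verts H'" if uv: "(u', v') \<in> edges H'" for u' v'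
      proof -
        obtain u v where *: "u' = p u" "v' = p v" "(u, v) \<in> edges H" using uv E by blast
        have **: "u \<in> verts H" "v \<in> verts H" using * sub by auto
        then show "f (r u') \<noteq> g (r v')" using * a r by (auto simp: cover_colourings_def)
        show "u' \<in> verts H'" "v' \<in> verts H'" using * ** im by auto
      qed
      moreover have "?m f \<in> verts H' \<rightarrow>\<^sub>E X" "?m g \<in> verts H' \<rightarrow>\<^sub>E Y"
        using a r' by (auto simp: cover_colourings_def)
      ultimately show "map_prod ?m ?m w \<in> cover_colourings H' X Y"
        by (auto simp: cover_colourings_def w)
    qed
    show "finite (cover_colourings H' X Y)" by (simp add: finite_cover_colourings fV' fin)
  qed
  have "card (colourings H' X) * card (colourings H' Y) \<le> card (colourings H X) * card (colourings H Y)"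
    using col fin by (simp add: mult_le_mono)
  also have "\<dots> \<le> card (cover_colourings H X Y)"
    using H fin by (auto simp: list_swappable_def)
  also note cov
  finally show "card (colourings H' X) * card (colourings H' Y) \<le> card (cover_colourings H' X Y)" .
qed

subsection \<open>Paths\<close>

definition path_graph :: "nat \<Rightarrow> nat graph" where
  "path_graph n = \<lparr>verts = {0..<n}, edges = {(i, j). i < n \<and> j < n \<and> (j = i + 1 \<or> i = j + 1)}\<rparr>"

lemma wf_path_graph: "wf_graph (path_graph n)"
  by (auto simp: wf_graph_def path_graph_def sym_def irrefl_def)

text \<open>The new end \<open>Suc n\<close> has to avoid only the colour of \<open>n\<close>, which
  does belong to \<open>X\<close>.\<close>

lemma colourings_path_graph_Suc_le:
  assumes X: "finite X"
  shows "card (colourings (path_graph (Suc (Suc n))) X) \<le> card (colourings (path_graph (Suc n)) X) * (card X - 1)"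
proof -
  let ?S = "SIGMA f : colourings (path_graph (Suc n)) X. X - {f n}"
  let ?m = "\<lambda>f. (restrict f {0..<Suc n}, f (Suc n))"
  have fin: "finite (colourings (path_graph (Suc n)) X)"
    using wf_path_graph[of "Suc n"] X by (auto simp: wf_graph_def finite_colourings)
  have "card (colourings (path_graph (Suc (Suc n))) X) \<le> card ?S"
  proof (rule card_inj_on_le)
    show "inj_on ?m (colourings (path_graph (Suc (Suc n))) X)"
    proof (rule inj_onI)
      fix f g assume fg: "f \<in> colourings (path_graph (Suc (Suc n))) X"
        "g \<in> colourings (path_graph (Suc (Suc n))) X" and e: "?m f = ?m g"
      have f: "f \<in> {0..<Suc (Suc n)} \<rightarrow>\<^sub>E X" and g: "g \<in> {0..<Suc (Suc n)} \<rightarrow>\<^sub>E X"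
        using fg by (auto simp: colourings_def path_graph_def)
      show "f = g"
      proof (rule PiE_ext[OF f g])
        fix v assume v: "v \<in> {0..<Suc (Suc n)}"
        show "f v = g v"
        proof (cases "v = Suc n")
          case False
          then have "v \<in> {0..<Suc n}" using v by auto
          moreover have "restrict f {0..<Suc n} v = restrict g {0..<Suc n} v" using e by simp
          ultimately show ?thesis by simp
        qed (use e in simp)
      qed
    qed
    show "?m ` colourings (path_graph (Suc (Suc n))) X \<subseteq> ?S"
      by (auto simp: colourings_def path_graph_def PiE_iff)
    show "finite ?S" using fin X by auto
  qed
  also have "\<dots> = (\<Sum>f\<in>colourings (path_graph (Suc n)) X. card (X - {f n}))"
    using fin X by (subst card_SigmaI) auto
  also have "\<dots> = (\<Sum>f\<in>colourings (path_graph (Suc n)) X. card X - 1)"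
    by (rule sum.cong) (auto simp: colourings_def path_graph_def PiE_iff)
  finally show ?thesis by simp
qed

text \<open>Each copy of the new end avoids one colour, that of \<open>n\<close> in the other copy.
  This colour may lie outside the list, so only a lower bound holds for the number of choices;
  truncated subtraction keeps it valid for empty lists.\<close>

lemma cover_colourings_path_graph_Suc_ge:
  assumes X: "finite X" and Y: "finite Y"
  shows "card (cover_colourings (path_graph (Suc n)) X Y) * ((card X - 1) * (card Y - 1))
    \<le> card (cover_colourings (path_graph (Suc (Suc n))) X Y)"
proof -
  let ?C = "cover_colourings (path_graph (Suc n)) X Y"
  let ?S = "SIGMA w : ?C. (X - {snd w n}) \<times> (Y - {fst w n})"
  let ?m = "\<lambda>(w, a, b). ((fst w)(Suc n := a), (snd w)(Suc n := b))"
  have fin: "finite ?C" "finite (cover_colourings (path_graph (Suc (Suc n))) X Y)"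
    using wf_path_graph[of "Suc n"] wf_path_graph[of "Suc (Suc n)"] X Y
    by (auto simp: wf_graph_def finite_cover_colourings)
  have step: "card Z - 1 \<le> card (Z - {z})" if "finite Z" for Z and z :: 'a
    using that by (simp add: card_Diff_singleton_if)
  have "card ?C * ((card X - 1) * (card Y - 1)) = (\<Sum>w\<in>?C. (card X - 1) * (card Y - 1))"
    by simp
  also have "\<dots> \<le> (\<Sum>w\<in>?C. card ((X - {snd w n}) \<times> (Y - {fst w n})))"
    by (rule sum_mono) (simp only: card_cartesian_product, intro mult_le_mono step X Y)
  also have "\<dots> = card ?S"
    using fin X Y by (subst card_SigmaI) auto
  also have "\<dots> \<le> card (cover_colourings (path_graph (Suc (Suc n))) X Y)"
  proof (rule card_inj_on_le)
    have ext: "f = f'" if "f \<in> {0..<Suc n} \<rightarrow>\<^sub>E Z" "f' \<in> {0..<Suc n} \<rightarrow>\<^sub>E Z"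
      "f(Suc n := a) = f'(Suc n := a')" for f f' :: "nat \<Rightarrow> 'a" and Z a a'
    proof (rule PiE_ext[OF that(1,2)])
      fix v assume "v \<in> {0..<Suc n}"
      then show "f v = f' v" using fun_cong[OF that(3), of v] by auto
    qed
    show "inj_on ?m ?S"
    proof (rule inj_onI)
      fix u w assume uw: "u \<in> ?S" "w \<in> ?S" and e: "?m u = ?m w"
      obtain f g a b f' g' a' b' where u: "u = ((f, g), a, b)" and w: "w = ((f', g'), a', b')"
        by (metis prod.collapse)
      have c: "(f, g) \<in> ?C" "(f', g') \<in> ?C" using uw unfolding u w by auto
      have e1: "f(Suc n := a) = f'(Suc n := a')" and e2: "g(Suc n := b) = g'(Suc n := b')"
        using e unfolding u w by auto
      have "f = f'" using c e1 by (intro ext[of f X f']) (auto simp: cover_colourings_def path_graph_def)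
      moreover have "g = g'" using c e2 by (intro ext[of g Y g']) (auto simp: cover_colourings_def path_graph_def)
      moreover have "a = a'" "b = b'" using fun_cong[OF e1, of "Suc n"] fun_cong[OF e2, of "Suc n"] by auto
      ultimately show "u = w" by (simp add: u w)
    qed
    show "?m ` ?S \<subseteq> cover_colourings (path_graph (Suc (Suc n))) X Y"
    proof (rule image_subsetI)
      fix w assume "w \<in> ?S"
      then obtain f g a b where w: "w = ((f, g), a, b)" and c: "(f, g) \<in> ?C"
        and ab: "a \<in> X" "b \<in> Y" "a \<noteq> g n" "b \<noteq> f n"
        by (cases w) auto
      have m: "f(Suc n := a) \<in> {0..<Suc (Suc n)} \<rightarrow>\<^sub>E X" "g(Suc n := b) \<in> {0..<Suc (Suc n)} \<rightarrow>\<^sub>E Y"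
        using c ab by (auto simp: cover_colourings_def path_graph_def PiE_iff extensional_def)
      have old: "f i \<noteq> g j" if "i < Suc n" "j < Suc n" "j = i + 1 \<or> i = j + 1" for i j
        using c that by (auto simp: cover_colourings_def path_graph_def)
      have "(f(Suc n := a)) i \<noteq> (g(Suc n := b)) j"
        if ij: "i < Suc (Suc n)" "j < Suc (Suc n)" "j = i + 1 \<or> i = j + 1" for i j
      proof -
        consider "i = Suc n" "j = n" | "j = Suc n" "i = n" | "i < Suc n" "j < Suc n" using ij by linarith
        then show ?thesis using old[of i j] ij(3) ab by cases auto
      qed
      then show "?m w \<in> cover_colourings (path_graph (Suc (Suc n))) X Y"
        using m by (auto simp: cover_colourings_def path_graph_def w)
    qed
    show "finite (cover_colourings (path_graph (Suc (Suc n))) X Y)" by (rule fin)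
  qed
  finally show ?thesis .
qed

lemma edgeless_card:
  assumes "edges H = {}" "finite (verts H)"
  shows "card (colourings H X) = card X ^ card (verts H)"
    and "card (cover_colourings H X Y) = card X ^ card (verts H) * card Y ^ card (verts H)"
proof -
  have "colourings H X = verts H \<rightarrow>\<^sub>E X" using assms by (auto simp: colourings_def)
  then show "card (colourings H X) = card X ^ card (verts H)" using assms by (simp add: card_PiE)
  have "cover_colourings H X Y = (verts H \<rightarrow>\<^sub>E X) \<times> (verts H \<rightarrow>\<^sub>E Y)"
    using assms by (auto simp: cover_colourings_def)
  then show "card (cover_colourings H X Y) = card X ^ card (verts H) * card Y ^ card (verts H)"
    using assms by (simp add: card_PiE card_cartesian_product)
qed

text \<open>Appending a vertex multiplies the left side by at most, and the right side by at least,
  the same factor. This works for arbitrary lists, without the reduction to nested ones.\<close>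

lemma list_swappable_path_graph: "list_swappable (path_graph (Suc n))"
  unfolding list_swappable_def
proof (intro allI impI)
  fix X Y :: "nat set" assume fin: "finite X" "finite Y"
  show "card (colourings (path_graph (Suc n)) X) * card (colourings (path_graph (Suc n)) Y)
    \<le> card (cover_colourings (path_graph (Suc n)) X Y)"
  proof (induction n)
    case 0
    have "edges (path_graph (Suc 0)) = {}" "finite (verts (path_graph (Suc 0)))"
      by (auto simp: path_graph_def)
    then show ?case by (simp add: edgeless_card)
  next
    case (Suc n)
    have "card (colourings (path_graph (Suc (Suc n))) X) * card (colourings (path_graph (Suc (Suc n))) Y)
      \<le> (card (colourings (path_graph (Suc n)) X) * (card X - 1)) *
        (card (colourings (path_graph (Suc n)) Y) * (card Y - 1))"
      by (intro mult_le_mono colourings_path_graph_Suc_le fin)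
    also have "\<dots> = (card (colourings (path_graph (Suc n)) X) * card (colourings (path_graph (Suc n)) Y)) *
        ((card X - 1) * (card Y - 1))" by (simp add: mult_ac)
    also have "\<dots> \<le> card (cover_colourings (path_graph (Suc n)) X Y) * ((card X - 1) * (card Y - 1))"
      by (intro mult_le_mono Suc.IH le_refl)
    also have "\<dots> \<le> card (cover_colourings (path_graph (Suc (Suc n))) X Y)"
      by (rule cover_colourings_path_graph_Suc_ge[OF fin])
    finally show ?case .
  qed
qed

lemma list_swappable_path:
  assumes "is_path H"
  shows "list_swappable H"
proof -
  obtain n :: nat and p where "n \<ge> 1" and p: "bij_betw p {0..<n} (verts H)"
    and E: "edges H = {(p i, p j) | i j. i < n \<and> j < n \<and> (j = i + 1 \<or> i = j + 1)}"
    using assms unfolding is_path_def by blast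
  then obtain m where "n = Suc m" by (cases n) auto
  then show ?thesis
    using p E by (intro list_swappable_isomorphic[OF _ _ wf_path_graph list_swappable_path_graph[of m]])
      (auto simp: path_graph_def)
qed

subsection \<open>Complete multipartite graphs\<close>

text \<open>This is the sum of \<open>\<phi>\<close> (number of elements of \<open>R\<close> that
  are missed) over all maps from an \<open>n\<close>-set to a \<open>z\<close>-set with a marked
  \<open>r\<close>-subset \<open>R\<close>. The recursion exposes one value: it avoids
  \<open>R\<close> in \<open>z - r\<close> ways or removes one of the \<open>r\<close> marked
  elements. At \<open>r = 0\<close> the truncated \<open>r - 1\<close> has coefficient 0.\<close>

fun occupancy :: "(nat \<Rightarrow> nat) \<Rightarrow> nat \<Rightarrow> nat \<Rightarrow> nat \<Rightarrow> nat" where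
  "occupancy \<phi> z 0 r = \<phi> r"
| "occupancy \<phi> z (Suc n) r = (z - r) * occupancy \<phi> z n r + r * occupancy \<phi> z n (r - 1)"

section \<open>Evaluation and comparison of occupancy sums\<close>

lemma sum_occupancy:
  fixes Q :: "'a set" and Z R :: "'b set"
  assumes "finite Q" "finite Z" "R \<subseteq> Z"
  shows "(\<Sum>g \<in> Q \<rightarrow>\<^sub>E Z. \<phi> (card (R - g ` Q))) = occupancy \<phi> (card Z) (card Q) (card R)"
  using assms(1,3)
proof (induction Q arbitrary: R)
  case empty
  then show ?case by simp
next
  case (insert v Q)
  have finR: "finite R" using insert assms finite_subset by blast
  have "(\<Sum>g \<in> insert v Q \<rightarrow>\<^sub>E Z. \<phi> (card (R - g ` insert v Q)))
    = (\<Sum>(z, g) \<in> Z \<times> (Q \<rightarrow>\<^sub>E Z). \<phi> (card (R - (g(v := z)) ` insert v Q)))"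
    unfolding PiE_insert_eq
    by (subst sum.reindex[OF inj_combinator[OF insert.hyps(2)]]) (simp only: o_def case_prod_unfold)
  also have "\<dots> = (\<Sum>z \<in> Z. \<Sum>g \<in> Q \<rightarrow>\<^sub>E Z. \<phi> (card (R - {z} - g ` Q)))"
    unfolding sum.cartesian_product[symmetric]
  proof (intro sum.cong refl)
    fix z :: 'b and g :: "'a \<Rightarrow> 'b"
    have "(g(v := z)) ` insert v Q = insert z (g ` Q)" using insert.hyps by auto
    then have "R - (g(v := z)) ` insert v Q = R - {z} - g ` Q" by auto
    then show "\<phi> (card (R - (g(v := z)) ` insert v Q)) = \<phi> (card (R - {z} - g ` Q))"
      by (simp only:)
  qed
  also have "\<dots> = (\<Sum>z \<in> Z. occupancy \<phi> (card Z) (card Q) (card (R - {z})))"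
    using insert.IH insert.prems by (intro sum.cong refl) blast
  also have "\<dots> = (\<Sum>z \<in> Z - R. occupancy \<phi> (card Z) (card Q) (card (R - {z})))
      + (\<Sum>z \<in> R. occupancy \<phi> (card Z) (card Q) (card (R - {z})))"
    using insert.prems assms(2) by (rule sum.subset_diff)
  also have "(\<Sum>z \<in> Z - R. occupancy \<phi> (card Z) (card Q) (card (R - {z})))
      = (card Z - card R) * occupancy \<phi> (card Z) (card Q) (card R)"
    using insert.prems finR by (simp add: card_Diff_subset)
  also have "(\<Sum>z \<in> R. occupancy \<phi> (card Z) (card Q) (card (R - {z})))
      = card R * occupancy \<phi> (card Z) (card Q) (card R - 1)"
    by simp
  finally show ?case using insert.hyps by simp
qed

lemma occupancy_mono:
  assumes "mono \<phi>" "r < z"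
  shows "occupancy \<phi> z n r \<le> occupancy \<phi> z n (Suc r)"
  using assms(2)
proof (induction n arbitrary: r)
  case 0
  then show ?case using assms(1) by (simp add: monoD)
next
  case (Suc n)
  let ?a = "occupancy \<phi> z n"
  have 1: "?a r \<le> ?a (Suc r)" using Suc by simp
  have 2: "r * ?a (r - 1) \<le> r * ?a r"
    using Suc.IH[of "r - 1"] Suc.prems by (cases r) (auto intro!: add_le_mono mult_le_mono)
  \<comment> \<open>Marking one more element leaves \<open>d\<close> values unmarked. Both
    recursions then have coefficients \<open>d\<close>, 1 and \<open>r\<close>, and are compared
    term by term.\<close>
  obtain d where z: "z = Suc (r + d)" using Suc.prems less_imp_Suc_add by auto
  have "(z - r) * ?a r = d * ?a r + ?a r" by (simp add: z)
  moreover have "(z - Suc r) * ?a (Suc r) \<ge> d * ?a r" using 1 by (simp add: z)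
  moreover have "Suc r * ?a (Suc r - 1) = ?a r + r * ?a r" by simp
  ultimately show ?case unfolding occupancy.simps using 2 by linarith
qed

lemma occupancy_mono_pred:
  assumes "mono \<phi>" "r \<le> z"
  shows "occupancy \<phi> z n (r - 1) \<le> occupancy \<phi> z n r"
  using occupancy_mono[OF assms(1), of "r - 1" z n] assms(2) by (cases r) auto

text \<open>Divided by \<open>x ^ n * y ^ n\<close>, this compares averages: a random map into more
  values hits a fixed marked set less often, so the average of \<open>\<phi>\<close> rises.\<close>

lemma occupancy_more_values:
  assumes "mono \<phi>" "r \<le> x" "x \<le> y"
  shows "y ^ n * occupancy \<phi> x n r \<le> x ^ n * occupancy \<phi> y n r"
  using assms(2)
proof (induction n arbitrary: r)
  case (Suc n)
  let ?a = "occupancy \<phi> x n" and ?b = "occupancy \<phi> y n"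
  obtain d where y: "y = x + d" using assms(3) le_Suc_ex by blast
  obtain e where x: "x = r + e" using Suc.prems le_Suc_ex by blast
  have b: "?b (r - 1) \<le> ?b r" using Suc.prems assms by (intro occupancy_mono_pred) auto
  have "y ^ Suc n * occupancy \<phi> x (Suc n) r = y * (e * (y ^ n * ?a r) + r * (y ^ n * ?a (r - 1)))"
    by (simp add: x algebra_simps)
  also have "\<dots> \<le> y * (e * (x ^ n * ?b r) + r * (x ^ n * ?b (r - 1)))"
    using Suc by (intro mult_le_mono add_le_mono Suc.IH le_refl) auto
  also have "\<dots> = x ^ n * (y * e * ?b r + (x * r * ?b (r - 1) + d * r * ?b (r - 1)))"
    by (simp add: y algebra_simps)
  \<comment> \<open>The hitting chances \<open>r / x\<close> and \<open>r / y\<close> differ by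
    \<open>d * r / (x * y)\<close>; this weight moves from \<open>?b (r - 1)\<close> to the larger
    \<open>?b r\<close>.\<close>
  also have "\<dots> \<le> x ^ n * (y * e * ?b r + (x * r * ?b (r - 1) + d * r * ?b r))"
    using b by (intro mult_le_mono add_le_mono le_refl) auto
  also have "\<dots> = x ^ Suc n * occupancy \<phi> y (Suc n) r"
    by (simp add: y x algebra_simps)
  finally show ?case .
qed simp

text \<open>Again a comparison of averages, now with \<open>d\<close> further marked elements that
  maps into the smaller set never hit. Allowing these values raises the chance of hitting a marked
  element from \<open>r / x\<close> to \<open>(d + r) / (x + d)\<close>.\<close>

lemma occupancy_fewer_values:
  assumes "mono \<phi>" "r \<le> x"
  shows "x ^ n * occupancy \<phi> (x + d) n (d + r) \<le> (x + d) ^ n * occupancy (\<lambda>k. \<phi> (d + k)) x n r"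
  using assms(2)
proof (induction n arbitrary: r)
  case (Suc n)
  let ?a = "occupancy \<phi> (x + d) n" and ?b = "occupancy (\<lambda>k. \<phi> (d + k)) x n"
  let ?y = "x + d"
  have mono': "mono (\<lambda>k. \<phi> (d + k))" using assms(1) by (auto simp: mono_def)
  obtain e where x: "x = r + e" using Suc.prems le_Suc_ex by blast
  have IH: "x ^ n * ?a (d + r) \<le> ?y ^ n * ?b r" using Suc by simp
  show ?case
  proof (cases r)
    \<comment> \<open>Here \<open>d + r - 1\<close> is not \<open>d + (r - 1)\<close> in truncated
      arithmetic unless \<open>d = 0\<close>, so monotonicity stands in for the induction hypothesis
      at \<open>r - 1\<close>.\<close>
    case 0
    have "?a (d - 1) \<le> ?a d" by (rule occupancy_mono_pred) (auto simp: assms)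
    then have "x * ?a d + d * ?a (d - 1) \<le> x * ?a d + d * ?a d" by simp
    then have "x ^ Suc n * occupancy \<phi> ?y (Suc n) (d + r) \<le> x ^ Suc n * (x * ?a d + d * ?a d)"
      by (simp add: 0)
    also have "\<dots> = x * ?y * (x ^ n * ?a (d + r))" by (simp add: 0 algebra_simps)
    also have "\<dots> \<le> x * ?y * (?y ^ n * ?b r)" by (intro mult_le_mono IH le_refl)
    also have "\<dots> = ?y ^ Suc n * occupancy (\<lambda>k. \<phi> (d + k)) x (Suc n) r" by (simp add: 0 algebra_simps)
    finally show ?thesis .
  next
    case (Suc s)
    have IH': "x ^ n * ?a (d + r - 1) \<le> ?y ^ n * ?b (r - 1)"
      using Suc.IH[of s] Suc.prems Suc by simp
    have b: "?b (r - 1) \<le> ?b r" using Suc.prems by (intro occupancy_mono_pred mono') auto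
    have "x ^ Suc n * occupancy \<phi> ?y (Suc n) (d + r)
      = x * (e * (x ^ n * ?a (d + r)) + (d + r) * (x ^ n * ?a (d + r - 1)))"
      by (simp add: x algebra_simps)
    also have "\<dots> \<le> x * (e * (?y ^ n * ?b r) + (d + r) * (?y ^ n * ?b (r - 1)))"
      by (intro mult_le_mono add_le_mono IH IH' le_refl)
    also have "\<dots> = ?y ^ n * (x * e * ?b r + (?y * r * ?b (r - 1) + d * e * ?b (r - 1)))"
      by (simp add: x algebra_simps)
    also have "\<dots> \<le> ?y ^ n * (x * e * ?b r + (?y * r * ?b (r - 1) + d * e * ?b r))"
      using b by (intro mult_le_mono add_le_mono le_refl) auto
    also have "\<dots> = ?y ^ Suc n * occupancy (\<lambda>k. \<phi> (d + k)) x (Suc n) r"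
      by (simp add: x algebra_simps)
    finally show ?thesis .
  qed
qed simp

text \<open>The two averaged comparisons are multiplied: missed elements of \<open>X\<close> favour
  maps into \<open>Y\<close>, and missed elements of \<open>Y\<close> favour maps into
  \<open>X\<close>. The total numbers of maps, \<open>x ^ n\<close> and \<open>y ^ n\<close>, then
  cancel.\<close>

lemma occupancy_exchange:
  fixes \<phi> :: "nat \<Rightarrow> nat"
  assumes Q: "finite Q" "Q \<noteq> {}" and Y: "finite Y" "X \<subseteq> Y" and \<phi>: "mono \<phi>"
  shows "(\<Sum>f \<in> Q \<rightarrow>\<^sub>E X. \<phi> (card (X - f ` Q))) * (\<Sum>g \<in> Q \<rightarrow>\<^sub>E Y. \<phi> (card (Y - g ` Q)))
    \<le> (\<Sum>f \<in> Q \<rightarrow>\<^sub>E X. \<phi> (card (Y - f ` Q))) * (\<Sum>g \<in> Q \<rightarrow>\<^sub>E Y. \<phi> (card (X - g ` Q)))"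
    (is "?XX * ?YY \<le> ?XY * ?YX")
proof (cases "X = {}")
  \<comment> \<open>Cancelling \<open>x ^ n\<close> needs \<open>x > 0\<close>; for empty
    \<open>X\<close> the left side vanishes because \<open>Q\<close> is nonempty.\<close>
  case True
  then have "Q \<rightarrow>\<^sub>E X = {}" using Q by (auto simp: PiE_eq_empty_iff)
  then show ?thesis by simp
next
  case False
  define x y n d where "x = card X" and "y = card Y" and "n = card Q" and "d = card (Y - X)"
  have X: "finite X" using Y finite_subset by blast
  have y: "y = x + d" using Y X by (simp add: x_def y_def d_def card_Diff_subset card_mono)
  have "0 < x" using False X by (auto simp: x_def card_gt_0_iff)
  have XX: "?XX = occupancy \<phi> x n x" and YY: "?YY = occupancy \<phi> y n y" and YX: "?YX = occupancy \<phi> y n x"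
    using Q X Y by (simp_all add: sum_occupancy x_def y_def n_def)
  have "?XY = (\<Sum>f \<in> Q \<rightarrow>\<^sub>E X. \<phi> (d + card (X - f ` Q)))"
  proof (intro sum.cong refl)
    fix f assume "f \<in> Q \<rightarrow>\<^sub>E X"
    then have "Y - f ` Q = (Y - X) \<union> (X - f ` Q)" using Y by auto
    moreover have "card ((Y - X) \<union> (X - f ` Q)) = d + card (X - f ` Q)"
      unfolding d_def using X Y by (intro card_Un_disjoint) auto
    ultimately show "\<phi> (card (Y - f ` Q)) = \<phi> (d + card (X - f ` Q))" by simp
  qed
  also have "\<dots> = occupancy (\<lambda>k. \<phi> (d + k)) x n x"
    using sum_occupancy[OF Q(1) X subset_refl, of "\<lambda>k. \<phi> (d + k)"] by (simp add: x_def n_def)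
  finally have XY: "?XY = occupancy (\<lambda>k. \<phi> (d + k)) x n x" .
  \<comment> \<open>\<open>A\<close> marks all of \<open>Y\<close>, as \<open>d\<close> elements
    outside \<open>X\<close> and \<open>x\<close> inside; \<open>B\<close> marks all of
    \<open>X\<close>.\<close>
  have A: "x ^ n * ?YY \<le> y ^ n * ?XY"
    using occupancy_fewer_values[OF \<phi> order_refl, of x n d] by (simp add: YY XY y add.commute)
  have B: "y ^ n * ?XX \<le> x ^ n * ?YX"
    unfolding XX YX using \<phi> by (intro occupancy_more_values) (auto simp: y)
  have "(x ^ n * y ^ n) * (?XX * ?YY) = (y ^ n * ?XX) * (x ^ n * ?YY)" by (simp only: mult_ac)
  also have "\<dots> \<le> (x ^ n * ?YX) * (y ^ n * ?XY)" by (intro mult_le_mono A B)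
  also have "\<dots> = (x ^ n * y ^ n) * (?XY * ?YX)" by (simp only: mult_ac)
  finally show ?thesis using \<open>0 < x\<close> by (simp add: y)
qed

section \<open>Splitting off one part of a complete multipartite graph\<close>

definition multipartite_graph :: "'a set \<Rightarrow> ('a \<Rightarrow> nat) \<Rightarrow> 'a graph" where
  "multipartite_graph V c = \<lparr>verts = V, edges = {(u, v). u \<in> V \<and> v \<in> V \<and> c u \<noteq> c v}\<rparr>"

lemma wf_multipartite_graph: "finite V \<Longrightarrow> wf_graph (multipartite_graph V c)"
  by (auto simp: wf_graph_def multipartite_graph_def sym_def irrefl_def)

text \<open>Every vertex outside the part \<open>Q\<close> is adjacent to all of \<open>Q\<close>,
  so the rest is coloured from the colours that \<open>Q\<close> does not use.\<close>

lemma colourings_multipartite_graph_le: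
  fixes X :: "nat set"
  assumes V: "finite V" and X: "finite X" and Q: "Q = {u \<in> V. c u = m}"
  shows "card (colourings (multipartite_graph V c) X)
    \<le> (\<Sum>f \<in> Q \<rightarrow>\<^sub>E X. card (colourings (multipartite_graph (V - Q) c) (X - f ` Q)))"
proof -
  let ?S = "SIGMA f : Q \<rightarrow>\<^sub>E X. colourings (multipartite_graph (V - Q) c) (X - f ` Q)"
  let ?m = "\<lambda>f. (restrict f Q, restrict f (V - Q))"
  have fin: "finite (Q \<rightarrow>\<^sub>E X)" using V X Q by (auto intro!: finite_PiE)
  have fin': "finite (colourings (multipartite_graph (V - Q) c) (X - f ` Q))" for f
    using V X by (intro finite_colourings) (auto simp: multipartite_graph_def)
  have "card (colourings (multipartite_graph V c) X) \<le> card ?S"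
  proof (rule card_inj_on_le)
    show "inj_on ?m (colourings (multipartite_graph V c) X)"
    proof (rule inj_onI)
      fix f g assume fg: "f \<in> colourings (multipartite_graph V c) X" "g \<in> colourings (multipartite_graph V c) X"
        and e: "?m f = ?m g"
      have f: "f \<in> V \<rightarrow>\<^sub>E X" and g: "g \<in> V \<rightarrow>\<^sub>E X"
        using fg by (auto simp: colourings_def multipartite_graph_def)
      have e1: "restrict f Q = restrict g Q" and e2: "restrict f (V - Q) = restrict g (V - Q)" using e by auto
      show "f = g"
      proof (rule PiE_ext[OF f g])
        fix v assume "v \<in> V"
        then show "f v = g v" using fun_cong[OF e1, of v] fun_cong[OF e2, of v] by (cases "v \<in> Q") auto
      qed
    qed
    show "?m ` colourings (multipartite_graph V c) X \<subseteq> ?S"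
    proof (rule image_subsetI)
      fix f assume f: "f \<in> colourings (multipartite_graph V c) X"
      have f1: "f v \<in> X" if "v \<in> V" for v using f that by (auto simp: colourings_def multipartite_graph_def)
      have f2: "f u \<noteq> f v" if "u \<in> V" "v \<in> V" "c u \<noteq> c v" for u v
        using f that by (auto simp: colourings_def multipartite_graph_def)
      have "f v \<notin> f ` Q" if "v \<in> V - Q" for v using that f2[of v] by (auto simp: Q)
      then show "?m f \<in> ?S"
        using f1 f2 by (auto simp: colourings_def multipartite_graph_def Q)
    qed
    show "finite ?S" using fin fin' by blast
  qed
  then show ?thesis using fin fin' by (subst (asm) card_SigmaI) auto
qed

text \<open>In the double cover the restrictions cross over: \<open>g\<close> on \<open>Q\<close>
  restricts the first copy of the rest, and \<open>f\<close> on \<open>Q\<close> the second.\<close>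

lemma cover_colourings_multipartite_graph_ge:
  fixes X Y :: "nat set"
  assumes V: "finite V" and X: "finite X" and Y: "finite Y" and Q: "Q = {u \<in> V. c u = m}"
  shows "(\<Sum>f \<in> Q \<rightarrow>\<^sub>E X. \<Sum>g \<in> Q \<rightarrow>\<^sub>E Y.
      card (cover_colourings (multipartite_graph (V - Q) c) (X - g ` Q) (Y - f ` Q)))
    \<le> card (cover_colourings (multipartite_graph V c) X Y)"
proof -
  let ?C = "\<lambda>f g. cover_colourings (multipartite_graph (V - Q) c) (X - g ` Q) (Y - f ` Q)"
  let ?S = "SIGMA w : (Q \<rightarrow>\<^sub>E X) \<times> (Q \<rightarrow>\<^sub>E Y). ?C (fst w) (snd w)"
  let ?j = "\<lambda>f f' v. if v \<in> Q then f v else f' v"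
  let ?m = "\<lambda>(w, w'). (?j (fst w) (fst w'), ?j (snd w) (snd w'))"
  have QV: "Q \<subseteq> V" using Q by auto
  have fin: "finite ((Q \<rightarrow>\<^sub>E X) \<times> (Q \<rightarrow>\<^sub>E Y))"
    using X Y finite_subset[OF QV V] by (auto intro!: finite_PiE)
  have fin': "finite (?C f g)" for f g
    using V X Y by (intro finite_cover_colourings) (auto simp: multipartite_graph_def)
  have "(\<Sum>f \<in> Q \<rightarrow>\<^sub>E X. \<Sum>g \<in> Q \<rightarrow>\<^sub>E Y. card (?C f g)) = card ?S"
    using fin fin' by (subst card_SigmaI) (auto simp: sum.cartesian_product case_prod_beta)
  also have "\<dots> \<le> card (cover_colourings (multipartite_graph V c) X Y)"
  proof (rule card_inj_on_le)
    have inj: "f = f' \<and> h = h'"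
      if f: "f \<in> Q \<rightarrow>\<^sub>E Z" "f' \<in> Q \<rightarrow>\<^sub>E Z" and h: "h \<in> V - Q \<rightarrow>\<^sub>E W" "h' \<in> V - Q \<rightarrow>\<^sub>E W'"
        and e: "?j f h = ?j f' h'" for f f' h h' :: "'a \<Rightarrow> nat" and Z W W'
    proof
      show "f = f'"
      proof (rule PiE_ext[OF f])
        fix v assume "v \<in> Q"
        then show "f v = f' v" using fun_cong[OF e, of v] by simp
      qed
      show "h = h'"
      proof
        fix v
        show "h v = h' v"
        proof (cases "v \<in> V - Q")
          case True
          then show ?thesis using fun_cong[OF e, of v] by simp
        next
          case False
          then show ?thesis using h by (metis PiE_arb)
        qed
      qed
    qed
    show "inj_on ?m ?S"
    proof (rule inj_onI)
      fix u w assume uw: "u \<in> ?S" "w \<in> ?S" and e: "?m u = ?m w"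
      obtain f g h k f' g' h' k' where u: "u = ((f, g), (h, k))" and w: "w = ((f', g'), (h', k'))"
        by (metis prod.collapse)
      have fh: "f \<in> Q \<rightarrow>\<^sub>E X" "f' \<in> Q \<rightarrow>\<^sub>E X" "h \<in> V - Q \<rightarrow>\<^sub>E X - g ` Q" "h' \<in> V - Q \<rightarrow>\<^sub>E X - g' ` Q"
        and gk: "g \<in> Q \<rightarrow>\<^sub>E Y" "g' \<in> Q \<rightarrow>\<^sub>E Y" "k \<in> V - Q \<rightarrow>\<^sub>E Y - f ` Q" "k' \<in> V - Q \<rightarrow>\<^sub>E Y - f' ` Q"
        using uw unfolding u w by (auto simp: cover_colourings_def multipartite_graph_def)
      have e1: "?j f h = ?j f' h'" and e2: "?j g k = ?j g' k'" 
        using e unfolding u w prod.case prod.inject fst_conv snd_conv by blast+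
      show "u = w" using inj[OF fh e1] inj[OF gk e2] by (simp add: u w)
    qed
    show "?m ` ?S \<subseteq> cover_colourings (multipartite_graph V c) X Y"
    proof (rule image_subsetI)
      fix u assume u': "u \<in> ?S"
      obtain f g h k where u: "u = ((f, g), (h, k))" by (metis prod.collapse)
      have f: "f \<in> Q \<rightarrow>\<^sub>E X" and g: "g \<in> Q \<rightarrow>\<^sub>E Y"
        and h: "h \<in> V - Q \<rightarrow>\<^sub>E X - g ` Q" and k: "k \<in> V - Q \<rightarrow>\<^sub>E Y - f ` Q"
        and hk: "\<And>u v. u \<in> V - Q \<Longrightarrow> v \<in> V - Q \<Longrightarrow> c u \<noteq> c v \<Longrightarrow> h u \<noteq> k v"
        using u' unfolding u by (auto simp: cover_colourings_def multipartite_graph_def)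
      have mem: "?j f h \<in> V \<rightarrow>\<^sub>E X" "?j g k \<in> V \<rightarrow>\<^sub>E Y"
        using f g h k QV by (auto simp: PiE_iff extensional_def)
      have "?j f h u \<noteq> ?j g k v" if uv: "u \<in> V" "v \<in> V" "c u \<noteq> c v" for u v
      proof -
        have "\<not> (u \<in> Q \<and> v \<in> Q)" using uv by (auto simp: Q)
        moreover have "f u \<noteq> k v" if "u \<in> Q" "v \<notin> Q" 
          using PiE_mem[OF k, of v] that uv by (metis DiffD2 DiffI imageI)
        moreover have "h u \<noteq> g v" if "u \<notin> Q" "v \<in> Q" 
          using PiE_mem[OF h, of u] that uv by (metis DiffD2 DiffI imageI)
        ultimately show ?thesis using hk[of u v] uv by auto
      qed
      then show "?m u \<in> cover_colourings (multipartite_graph V c) X Y"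
        using mem unfolding u prod.case fst_conv snd_conv
        by (simp add: cover_colourings_def multipartite_graph_def del: if_split)
    qed
    show "finite (cover_colourings (multipartite_graph V c) X Y)"
      using V X Y by (intro finite_cover_colourings) (auto simp: multipartite_graph_def)
  qed
  finally show ?thesis .
qed

lemma list_swappable_multipartite_graph:
  assumes "finite V"
  shows "list_swappable (multipartite_graph V c)"
  using assms
proof (induction "card V" arbitrary: V rule: less_induct)
  case less
  note V = \<open>finite V\<close>
  show ?case
  proof (rule list_swappable_if_nested[OF wf_multipartite_graph[OF V]])
    fix X Y :: "nat set" assume Y: "finite Y" "X \<subseteq> Y"
    then have X: "finite X" using finite_subset by blast
    let ?H = "multipartite_graph V c"
    show "card (colourings ?H X) * card (colourings ?H Y) \<le> card (cover_colourings ?H X Y)"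
    proof (cases "V = {}")
      case True
      then have "colourings ?H X = {\<lambda>_. undefined}" "colourings ?H Y = {\<lambda>_. undefined}"
        "cover_colourings ?H X Y = {(\<lambda>_. undefined, \<lambda>_. undefined)}"
        by (auto simp: colourings_def cover_colourings_def multipartite_graph_def)
      then show ?thesis by simp
    next
      case False
      then obtain v where v: "v \<in> V" by auto
      define Q where "Q = {u \<in> V. c u = c v}"
      let ?H' = "multipartite_graph (V - Q) c"
      have Q: "finite Q" "Q \<noteq> {}" "Q \<subseteq> V" using V v by (auto simp: Q_def)
      have sw: "list_swappable ?H'"
        using Q V by (intro less.hyps) (auto intro!: psubset_card_mono)
      \<comment> \<open>The number of colourings of the remaining parts depends only on how many
        colours are left, and grows with it; this is the weight in the occupancy sums.\<close>
      define \<phi> where "\<phi> r = card (colourings ?H' {0..<r})" for r :: nat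
      have H': "edges ?H' \<subseteq> verts ?H' \<times> verts ?H'" "finite (verts ?H')"
        using V by (auto simp: multipartite_graph_def)
      have \<phi>: "card (colourings ?H' Z) = \<phi> (card Z)" if "finite Z" for Z
        unfolding \<phi>_def using that H' by (intro antisym colourings_card_mono) auto
      have "mono \<phi>" unfolding \<phi>_def by (intro monoI colourings_card_mono H') auto
      have "card (colourings ?H X) * card (colourings ?H Y)
        \<le> (\<Sum>f \<in> Q \<rightarrow>\<^sub>E X. \<phi> (card (X - f ` Q))) * (\<Sum>g \<in> Q \<rightarrow>\<^sub>E Y. \<phi> (card (Y - g ` Q)))"
        using colourings_multipartite_graph_le[OF V X Q_def] colourings_multipartite_graph_le[OF V Y(1) Q_def] X Y
        by (intro mult_le_mono) (simp_all add: \<phi>)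
      also have "\<dots> \<le> (\<Sum>f \<in> Q \<rightarrow>\<^sub>E X. \<phi> (card (Y - f ` Q))) * (\<Sum>g \<in> Q \<rightarrow>\<^sub>E Y. \<phi> (card (X - g ` Q)))"
        by (rule occupancy_exchange) fact+
      also have "\<dots> = (\<Sum>f \<in> Q \<rightarrow>\<^sub>E X. \<Sum>g \<in> Q \<rightarrow>\<^sub>E Y.
          card (colourings ?H' (X - g ` Q)) * card (colourings ?H' (Y - f ` Q)))"
        using X Y by (simp only: sum_product \<phi> finite_Diff, intro sum.cong refl mult.commute)
      \<comment> \<open>The induction hypothesis is needed here for lists that may no longer be
        nested.\<close>
      also have "\<dots> \<le> (\<Sum>f \<in> Q \<rightarrow>\<^sub>E X. \<Sum>g \<in> Q \<rightarrow>\<^sub>E Y. card (cover_colourings ?H' (X - g ` Q) (Y - f ` Q)))"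
        using sw X Y by (intro sum_mono) (auto simp: list_swappable_def)
      also have "\<dots> \<le> card (cover_colourings ?H X Y)"
        by (rule cover_colourings_multipartite_graph_ge[OF V X Y(1) Q_def])
      finally show ?thesis .
    qed
  qed
qed

lemma list_swappable_complete_multipartite:
  assumes "complete_multipartite H" "wf_graph H"
  shows "list_swappable H"
proof -
  obtain c :: "'a \<Rightarrow> nat" where "edges H = {(u, v). u \<in> verts H \<and> v \<in> verts H \<and> c u \<noteq> c v}"
    using assms(1) by (auto simp: complete_multipartite_def)
  then have "H = multipartite_graph (verts H) c"
    by (simp add: multipartite_graph_def)
  moreover have "list_swappable (multipartite_graph (verts H) c)"
    using assms(2) by (intro list_swappable_multipartite_graph) (simp add: wf_graph_def)
  ultimately show ?thesis by simp
qed

subsection \<open>Even cycles\<close>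

text \<open>The lists depend on the position so that they can alternate between \<open>X\<close> and
  \<open>Y\<close> along a cycle.\<close>

definition walks :: "(nat \<Rightarrow> 'c set) \<Rightarrow> nat \<Rightarrow> 'c \<Rightarrow> 'c \<Rightarrow> (nat \<Rightarrow> 'c) set" where
  "walks L m a b = {w \<in> Pi\<^sub>E {0..m} L. w 0 = a \<and> w m = b \<and> (\<forall>i<m. w i \<noteq> w (Suc i))}"

definition closed_walks :: "(nat \<Rightarrow> 'c set) \<Rightarrow> nat \<Rightarrow> (nat \<Rightarrow> 'c) set" where
  "closed_walks L n = {w \<in> Pi\<^sub>E {0..<n} L. \<forall>i<n. w i \<noteq> w ((i + 1) mod n)}"

section \<open>Transfer-matrix counts of walks and closed walks\<close>

lemma finite_walks: "(\<And>i. finite (L i)) \<Longrightarrow> finite (walks L m a b)"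
  by (rule finite_subset[of _ "Pi\<^sub>E {0..m} L"]) (auto simp: walks_def intro!: finite_PiE)

lemma finite_closed_walks: "(\<And>i. finite (L i)) \<Longrightarrow> finite (closed_walks L n)"
  by (rule finite_subset[of _ "Pi\<^sub>E {0..<n} L"]) (auto simp: closed_walks_def intro!: finite_PiE)

lemma card_walks_0:
  assumes "a \<in> L 0"
  shows "card (walks L 0 a b) = of_bool (a = b)"
proof (cases "a = b")
  case True
  have "walks L 0 a b = {\<lambda>i\<in>{0}. a}"
  proof (intro equalityI subsetI)
    fix w assume "w \<in> walks L 0 a b"
    then show "w \<in> {\<lambda>i\<in>{0}. a}"
      by (auto simp: walks_def PiE_iff extensional_def restrict_def)
  qed (use assms True in \<open>auto simp: walks_def\<close>)
  then show ?thesis using True by simp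
next
  case False
  then have "walks L 0 a b = {}" by (auto simp: walks_def)
  then show ?thesis using False by simp
qed

lemma card_walks_Suc:
  assumes fin: "\<And>i. finite (L i)" and b: "b \<in> L (Suc m)"
  shows "card (walks L (Suc m) a b) = (\<Sum>c \<in> L m - {b}. card (walks L m a c))"
proof -
  have "bij_betw (\<lambda>w. restrict w {0..m}) (walks L (Suc m) a b) (\<Union>c \<in> L m - {b}. walks L m a c)"
  proof (rule bij_betw_byWitness[where f' = "\<lambda>w. w(Suc m := b)"])
    show "\<forall>w \<in> walks L (Suc m) a b. (restrict w {0..m})(Suc m := b) = w"
    proof (intro ballI ext)
      fix w i assume w: "w \<in> walks L (Suc m) a b"
      show "((restrict w {0..m})(Suc m := b)) i = w i"
        using w by (cases "i \<le> m"; cases "i = Suc m") (auto simp: walks_def PiE_iff extensional_def)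
    qed
    show "\<forall>w \<in> \<Union>c \<in> L m - {b}. walks L m a c. restrict (w(Suc m := b)) {0..m} = w"
      by (auto simp: walks_def PiE_iff extensional_def restrict_def)
    show "(\<lambda>w. restrict w {0..m}) ` walks L (Suc m) a b \<subseteq> (\<Union>c \<in> L m - {b}. walks L m a c)"
    proof (rule image_subsetI)
      fix w assume w: "w \<in> walks L (Suc m) a b"
      then have "restrict w {0..m} \<in> walks L m a (w m)" "w m \<in> L m - {b}"
        by (auto simp: walks_def PiE_iff)
      then show "restrict w {0..m} \<in> (\<Union>c \<in> L m - {b}. walks L m a c)" by blast
    qed
    show "(\<lambda>w. w(Suc m := b)) ` (\<Union>c \<in> L m - {b}. walks L m a c) \<subseteq> walks L (Suc m) a b"
    proof (rule image_subsetI)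
      fix w assume "w \<in> (\<Union>c \<in> L m - {b}. walks L m a c)"
      then have w: "w \<in> Pi\<^sub>E {0..m} L" "w 0 = a" "w m \<noteq> b" "\<And>i. i < m \<Longrightarrow> w i \<noteq> w (Suc i)"
        by (auto simp: walks_def)
      have "w(Suc m := b) \<in> Pi\<^sub>E {0..Suc m} L"
        using w(1) b by (auto simp: PiE_iff extensional_def le_Suc_eq)
      then show "w(Suc m := b) \<in> walks L (Suc m) a b"
        using w by (auto simp: walks_def less_Suc_eq)
    qed
  qed
  then have "card (walks L (Suc m) a b) = card (\<Union>c \<in> L m - {b}. walks L m a c)"
    by (rule bij_betw_same_card)
  also have "\<dots> = (\<Sum>c \<in> L m - {b}. card (walks L m a c))"
    using fin finite_walks[OF fin] by (intro card_UN_disjoint) (auto simp: walks_def)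
  finally show ?thesis .
qed

text \<open>The cycle is cut open at position 0, whose colour is repeated at position
  \<open>n\<close>; \<open>L n = L 0\<close> makes the repeated colour admissible.\<close>

lemma card_closed_walks:
  assumes fin: "\<And>i. finite (L i)" and n: "0 < n" and L: "L n = L 0"
  shows "card (closed_walks L n) = (\<Sum>a \<in> L 0. card (walks L n a a))"
proof -
  have mod: "(i + 1) mod n = (if Suc i = n then 0 else Suc i)" if "i < n" for i
    using that by auto
  have "bij_betw (\<lambda>w. w(n := w 0)) (closed_walks L n) (\<Union>a \<in> L 0. walks L n a a)"
  proof (rule bij_betw_byWitness[where f' = "\<lambda>w. restrict w {0..<n}"])
    show "\<forall>w \<in> closed_walks L n. restrict (w(n := w 0)) {0..<n} = w"
      by (auto simp: closed_walks_def PiE_iff extensional_def restrict_def)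
    show "\<forall>w \<in> \<Union>a \<in> L 0. walks L n a a. (restrict w {0..<n})(n := restrict w {0..<n} 0) = w"
    proof (intro ballI ext)
      fix w i assume w: "w \<in> (\<Union>a \<in> L 0. walks L n a a)"
      show "((restrict w {0..<n})(n := restrict w {0..<n} 0)) i = w i"
        using w n by (cases "i < n"; cases "i = n") (auto simp: walks_def PiE_iff extensional_def)
    qed
    show "(\<lambda>w. w(n := w 0)) ` closed_walks L n \<subseteq> (\<Union>a \<in> L 0. walks L n a a)"
    proof (rule image_subsetI)
      fix w assume "w \<in> closed_walks L n"
      then have w: "w \<in> Pi\<^sub>E {0..<n} L" and s: "\<And>i. i < n \<Longrightarrow> w i \<noteq> w (if Suc i = n then 0 else Suc i)"
        using mod by (auto simp: closed_walks_def)
      have w0: "w 0 \<in> L 0" using w n by (auto simp: PiE_iff)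
      have "w(n := w 0) \<in> Pi\<^sub>E {0..n} L"
        using w w0 L by (auto simp: PiE_iff extensional_def)
      moreover have "(w(n := w 0)) i \<noteq> (w(n := w 0)) (Suc i)" if "i < n" for i
        using s[OF that] that by auto
      ultimately have "w(n := w 0) \<in> walks L n (w 0) (w 0)" using n by (auto simp: walks_def)
      then show "w(n := w 0) \<in> (\<Union>a \<in> L 0. walks L n a a)" using w0 by blast
    qed
    show "(\<lambda>w. restrict w {0..<n}) ` (\<Union>a \<in> L 0. walks L n a a) \<subseteq> closed_walks L n"
    proof (rule image_subsetI)
      fix w assume "w \<in> (\<Union>a \<in> L 0. walks L n a a)"
      then have w: "w \<in> Pi\<^sub>E {0..n} L" "w n = w 0" and s: "\<And>i. i < n \<Longrightarrow> w i \<noteq> w (Suc i)"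
        by (auto simp: walks_def)
      have "w i \<noteq> w ((i + 1) mod n)" if "i < n" for i
        using s[OF that] mod[OF that] w(2) by auto
      then show "restrict w {0..<n} \<in> closed_walks L n"
        using w n by (auto simp: closed_walks_def PiE_iff)
    qed
  qed
  then have "card (closed_walks L n) = card (\<Union>a \<in> L 0. walks L n a a)"
    by (rule bij_betw_same_card)
  also have "\<dots> = (\<Sum>a \<in> L 0. card (walks L n a a))"
    using fin finite_walks[OF fin] by (intro card_UN_disjoint) (auto simp: walks_def)
  finally show ?thesis .
qed

abbreviation alternating :: "'c set \<Rightarrow> 'c set \<Rightarrow> nat \<Rightarrow> 'c set" where
  "alternating X Y \<equiv> \<lambda>i. if even i then X else Y"

text \<open>The \<open>X \<times> X\<close> matrix counting two-step walks through \<open>Y \<supseteq> X\<close> is \<open>(y - 2) J + I\<close>; its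
  \<open>j\<close>-th power is \<open>I + t J\<close> with \<open>t = walk_excess x y j\<close>.\<close>
fun walk_excess :: "int \<Rightarrow> int \<Rightarrow> nat \<Rightarrow> int" where
  "walk_excess x y 0 = 0"
| "walk_excess x y (Suc j) = walk_excess x y j + (y - 2) * (1 + x * walk_excess x y j)"

text \<open>The left side is the eigenvalue of \<open>I + t J\<close> on the constant vector, hence
  the \<open>j\<close>-th power of the eigenvalue for two steps.\<close>

lemma walk_excess_closed_form: "1 + x * walk_excess x y j = (1 + x * (y - 2)) ^ j"
proof (induction j)
  case (Suc j)
  have "1 + x * walk_excess x y (Suc j) = (1 + x * (y - 2)) * (1 + x * walk_excess x y j)"
    by (simp add: algebra_simps)
  then show ?case using Suc by simp
qed simp

lemma card_walks_alternating:
  assumes Y: "finite Y" "X \<subseteq> Y" and a: "a \<in> X" and b: "b \<in> X"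
  shows "int (card (walks (alternating X Y) (2 * j) a b))
    = of_bool (a = b) + walk_excess (int (card X)) (int (card Y)) j"
  using b
proof (induction j arbitrary: b)
  case 0
  then show ?case using a by (simp add: card_walks_0)
next
  case (Suc j)
  let ?L = "alternating X Y" and ?x = "int (card X)" and ?y = "int (card Y)"
  let ?t = "walk_excess ?x ?y j"
  have X: "finite X" using Y finite_subset by blast
  have fin: "finite (?L i)" for i using X Y by simp
  \<comment> \<open>One more step, into a colour \<open>c\<close> of \<open>Y\<close>: the row of
    \<open>a\<close> in \<open>I + t J\<close> is summed over \<open>X - {c}\<close>. The diagonal
    entry is lost when \<open>c = a\<close>, and one \<open>t\<close> is lost when
    \<open>c \<in> X\<close>.\<close>
  have odd: "int (card (walks ?L (Suc (2 * j)) a c)) = of_bool (a \<noteq> c) + ?t * (?x - of_bool (c \<in> X))"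
    if c: "c \<in> Y" for c
  proof -
    have "int (card (walks ?L (Suc (2 * j)) a c)) = (\<Sum>d \<in> X - {c}. int (card (walks ?L (2 * j) a d)))"
      using c by (subst card_walks_Suc) (auto simp: fin)
    also have "\<dots> = (\<Sum>d \<in> X - {c}. of_bool (a = d) + ?t)"
      using Suc.IH by (intro sum.cong) auto
    also have "\<dots> = (\<Sum>d \<in> X - {c}. if a = d then 1 else 0) + int (card (X - {c})) * ?t"
      by (simp add: sum.distrib of_bool_def)
    also have "(\<Sum>d \<in> X - {c}. if a = d then 1 else 0 :: int) = of_bool (a \<noteq> c)"
      using X a by (subst sum.delta') auto
    also have "int (card (X - {c})) = ?x - of_bool (c \<in> X)"
    proof (cases "c \<in> X")
      case True
      then have "0 < card X" using X by (auto simp: card_gt_0_iff)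
      then show ?thesis using True X by (simp add: of_nat_diff)
    qed simp
    finally show ?thesis by (simp add: mult.commute)
  qed
  let ?h = "\<lambda>c. of_bool (a \<noteq> c) + ?t * (?x - of_bool (c \<in> X)) :: int"
  have bY: "b \<in> Y" and aY: "a \<in> Y" using Suc.prems a Y by auto
  have "int (card (walks ?L (2 * Suc j) a b)) = int (card (walks ?L (Suc (Suc (2 * j))) a b))"
    by simp
  also have "\<dots> = (\<Sum>c \<in> Y - {b}. int (card (walks ?L (Suc (2 * j)) a c)))"
    using Suc.prems by (subst card_walks_Suc) (auto simp: fin)
  also have "\<dots> = (\<Sum>c \<in> Y - {b}. ?h c)"
    using odd by (intro sum.cong) auto
  also have "\<dots> = (\<Sum>c \<in> Y. ?h c) - ?h b"
    using Y bY by (simp add: sum_diff1)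
  also have "(\<Sum>c \<in> Y. ?h c) = (\<Sum>c \<in> Y. of_bool (a \<noteq> c)) + ?t * (?y * ?x - (\<Sum>c \<in> Y. of_bool (c \<in> X)))"
    by (simp add: sum.distrib sum_distrib_left[symmetric] sum_subtractf)
  also have "(\<Sum>c \<in> Y. of_bool (a \<noteq> c) :: int) = ?y - 1"
  proof -
    have "(\<Sum>c \<in> Y. of_bool (a \<noteq> c) :: int) = (\<Sum>c \<in> Y. 1 - (if a = c then 1 else 0))"
      by (intro sum.cong) auto
    also have "\<dots> = ?y - 1" using Y aY by (simp add: sum_subtractf)
    finally show ?thesis .
  qed
  also have "(\<Sum>c \<in> Y. of_bool (c \<in> X) :: int) = ?x"
  proof -
    have "(\<Sum>c \<in> Y. of_bool (c \<in> X) :: int) = (\<Sum>c \<in> Y \<inter> X. 1)"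
      by (simp only: sum.inter_restrict[OF Y(1)] of_bool_def)
    then show ?thesis using Y by (simp add: Int_absorb1)
  qed
  finally show ?case using Suc.prems by (cases "a = b") (simp_all add: algebra_simps)
qed

text \<open>For nonempty \<open>X\<close> this is a trace: the eigenvalue
  \<open>1 + x (y - 2)\<close> is simple on the constant vector, and 1 occurs on the vectors of sum
  0. For \<open>X = Y\<close> it is the chromatic polynomial of the cycle.\<close>

lemma card_closed_walks_alternating:
  assumes "finite Y" "X \<subseteq> Y" "0 < k"
  shows "int (card (closed_walks (alternating X Y) (2 * k)))
    = (1 + int (card X) * (int (card Y) - 2)) ^ k + int (card X) - 1"
proof -
  let ?x = "int (card X)" and ?y = "int (card Y)"
  have "finite X" using assms finite_subset by blast
  then have "card (closed_walks (alternating X Y) (2 * k))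
    = (\<Sum>a \<in> X. card (walks (alternating X Y) (2 * k) a a))"
    using assms by (subst card_closed_walks) auto
  then have "int (card (closed_walks (alternating X Y) (2 * k)))
    = (\<Sum>a \<in> X. 1 + walk_excess ?x ?y k)"
    using card_walks_alternating[OF assms(1,2)] by simp
  also have "\<dots> = (1 + ?x * walk_excess ?x ?y k) + ?x - 1" by (simp add: algebra_simps)
  finally show ?thesis by (simp only: walk_excess_closed_form)
qed

section \<open>Even cycles and their double covers\<close>

definition cycle_graph :: "nat \<Rightarrow> nat graph" where
  "cycle_graph n = \<lparr>verts = {0..<n},
     edges = {(i, j). i < n \<and> j < n \<and> (j = (i + 1) mod n \<or> i = (j + 1) mod n)}\<rparr>"

lemma wf_cycle_graph:
  assumes "2 \<le> n"
  shows "wf_graph (cycle_graph n)"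
proof -
  have "i \<noteq> (i + 1) mod n" if "i < n" for i
    using that assms by (cases "Suc i = n") auto
  then show ?thesis by (auto simp: wf_graph_def cycle_graph_def sym_def irrefl_def)
qed

lemma colourings_cycle_graph: "colourings (cycle_graph n) X = closed_walks (alternating X X) n"
proof -
  have "(\<forall>(u, v) \<in> edges (cycle_graph n). f u \<noteq> f v) \<longleftrightarrow> (\<forall>i<n. f i \<noteq> f ((i + 1) mod n))"
    for f :: "nat \<Rightarrow> 'a"
    by (auto simp: cycle_graph_def)
  moreover have "verts (cycle_graph n) = {0..<n}" by (simp add: cycle_graph_def)
  ultimately show ?thesis by (simp add: colourings_def closed_walks_def)
qed

text \<open>The double cover of an even cycle consists of two disjoint cycles of the same length,
  and the lists alternate between \<open>X\<close> and \<open>Y\<close> along each.\<close>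

lemma cover_colourings_cycle_graph_ge:
  fixes X Y :: "'c set"
  assumes X: "finite X" and Y: "finite Y" and n: "even n" "0 < n"
  shows "card (closed_walks (alternating X Y) n) ^ 2 \<le> card (cover_colourings (cycle_graph n) X Y)"
proof -
  let ?W = "closed_walks (alternating X Y) n"
  \<comment> \<open>The cyclic predecessor. \<open>\<alpha>\<close> colours the component with the
    even vertices in the first copy; \<open>\<beta>\<close> colours the other one, shifted by one
    position so that its even positions also carry the list \<open>X\<close>.\<close>
  define pr where "pr i = (if i = 0 then n - 1 else i - 1)" for i
  have pr: "pr i < n" "(pr i + 1) mod n = i" "even (pr i) \<longleftrightarrow> odd i" if "i < n" for i
    using that n by (auto simp: pr_def)
  have pr': "pr ((i + 1) mod n) = i" if "i < n" for i
    using that by (cases "Suc i = n") (auto simp: pr_def)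
  have par: "even ((i + 1) mod n) \<longleftrightarrow> odd i" for i
    using n(1) by (simp add: dvd_mod_iff)
  let ?f = "\<lambda>\<alpha> \<beta> :: nat \<Rightarrow> 'c. \<lambda>i\<in>{0..<n}. if even i then \<alpha> i else \<beta> (pr i)"
  let ?g = "\<lambda>\<alpha> \<beta> :: nat \<Rightarrow> 'c. \<lambda>i\<in>{0..<n}. if odd i then \<alpha> i else \<beta> (pr i)"
  let ?m = "\<lambda>(\<alpha>, \<beta>). (?f \<alpha> \<beta>, ?g \<alpha> \<beta>)"
  have "card (?W \<times> ?W) \<le> card (cover_colourings (cycle_graph n) X Y)"
  proof (rule card_inj_on_le)
    show "inj_on ?m (?W \<times> ?W)"
    proof (rule inj_onI)
      fix u w assume uw: "u \<in> ?W \<times> ?W" "w \<in> ?W \<times> ?W" and e: "?m u = ?m w"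
      obtain \<alpha> \<beta> \<alpha>' \<beta>' where u: "u = (\<alpha>, \<beta>)" and w: "w = (\<alpha>', \<beta>')" by (cases u, cases w) auto
      have e1: "?f \<alpha> \<beta> = ?f \<alpha>' \<beta>'" and e2: "?g \<alpha> \<beta> = ?g \<alpha>' \<beta>'" using e unfolding u w by simp_all
      have eq: "\<alpha> i = \<alpha>' i \<and> \<beta> (pr i) = \<beta>' (pr i)" if "i < n" for i
        using fun_cong[OF e1, of i] fun_cong[OF e2, of i] that by (cases "even i") simp_all
      have \<alpha>: "\<alpha> \<in> Pi\<^sub>E {0..<n} (alternating X Y)" "\<alpha>' \<in> Pi\<^sub>E {0..<n} (alternating X Y)"
        and \<beta>: "\<beta> \<in> Pi\<^sub>E {0..<n} (alternating X Y)" "\<beta>' \<in> Pi\<^sub>E {0..<n} (alternating X Y)"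
        using uw unfolding u w by (auto simp: closed_walks_def)
      have "\<alpha> = \<alpha>'" by (rule PiE_ext[OF \<alpha>]) (use eq in auto)
      moreover have "\<beta> = \<beta>'"
      proof (rule PiE_ext[OF \<beta>])
        fix i assume "i \<in> {0..<n}"
        then show "\<beta> i = \<beta>' i" using eq[of "(i + 1) mod n"] pr'[of i] n by simp
      qed
      ultimately show "u = w" by (simp add: u w)
    qed
    show "?m ` (?W \<times> ?W) \<subseteq> cover_colourings (cycle_graph n) X Y"
    proof (rule image_subsetI)
      fix w assume w': "w \<in> ?W \<times> ?W"
      obtain \<alpha> \<beta> where w: "w = (\<alpha>, \<beta>)" by (cases w)
      have mem: "\<alpha> i \<in> alternating X Y i" "\<beta> i \<in> alternating X Y i" if "i < n" for i
        using w' that unfolding w by (auto simp: closed_walks_def PiE_iff simp del: if_split)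
      have st: "\<alpha> i \<noteq> \<alpha> ((i + 1) mod n)" "\<beta> i \<noteq> \<beta> ((i + 1) mod n)" if "i < n" for i
        using w' that unfolding w by (auto simp: closed_walks_def)
      have ev: "\<alpha> i \<in> X" "\<beta> (pr i) \<in> Y" if "i < n" "even i" for i
        using mem(1)[OF that(1)] mem(2)[OF pr(1)[OF that(1)]] pr(3)[OF that(1)] that(2) by simp_all
      have od: "\<alpha> i \<in> Y" "\<beta> (pr i) \<in> X" if "i < n" "odd i" for i
        using mem(1)[OF that(1)] mem(2)[OF pr(1)[OF that(1)]] pr(3)[OF that(1)] that(2) by simp_all
      have f: "?f \<alpha> \<beta> \<in> {0..<n} \<rightarrow>\<^sub>E X" and g: "?g \<alpha> \<beta> \<in> {0..<n} \<rightarrow>\<^sub>E Y"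
        using ev od by auto
      have "?f \<alpha> \<beta> i \<noteq> ?g \<alpha> \<beta> j" if i: "i < n" and j: "j < n" and ij: "j = (i + 1) mod n \<or> i = (j + 1) mod n" for i j
      proof -
        have p: "even j \<longleftrightarrow> odd i" using ij par[of i] par[of j] by auto
        have "\<alpha> i \<noteq> \<alpha> j" using ij st(1)[OF i] st(1)[OF j] by auto
        moreover have "\<beta> (pr i) \<noteq> \<beta> (pr j)"
          using ij st(2)[OF pr(1)[OF i]] st(2)[OF pr(1)[OF j]] pr(2)[OF i] pr(2)[OF j] pr'[OF i] pr'[OF j]
          by auto
        ultimately show ?thesis using i j p by simp
      qed
      then show "?m w \<in> cover_colourings (cycle_graph n) X Y"
        using f g by (simp add: cover_colourings_def cycle_graph_def w)
    qed
    show "finite (cover_colourings (cycle_graph n) X Y)"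
      using X Y by (intro finite_cover_colourings) (auto simp: cycle_graph_def)
  qed
  then show ?thesis by (simp add: card_cartesian_product power2_eq_square)
qed

text \<open>Expanding both sides with \<open>v = a * b + b - a\<close>, the inequality is the sum of \<open>big\<close> and \<open>small\<close>;
  for \<open>k = 1\<close> these have slack \<open>b * (a + 1) * (b - a)\<close> and \<open>0\<close>.\<close>
lemma cycle_count_inequality:
  fixes a b :: int
  assumes "0 \<le> a" "a \<le> b" "0 < k"
  shows "((a * a) ^ k + a) * ((b * b) ^ k + b) \<le> ((a * b + b - a) ^ k + a) ^ 2"
proof (cases "a = 0")
  case True
  then show ?thesis using assms by (simp add: zero_power)
next
  case False
  define v where "v = a * b + b - a"
  have a: "1 \<le> a" and b: "1 \<le> b" using False assms by auto
  have ab: "a * a \<le> a * b" "a \<le> a * b" "b \<le> a * b" "1 \<le> a * b"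
    using a b assms mult_mono[of 1 a 1 b] by (auto simp: mult_left_mono mult_le_cancel_left1 mult_le_cancel_right1)
  have v: "a * b \<le> v" "1 \<le> v" "a * a \<le> v" using ab assms by (auto simp: v_def)
  \<comment> \<open>For \<open>a \<ge> 2\<close> the chain is
    \<open>v \<le> 2 * (a * b) \<le> (a * b) * (a * b)\<close>; for \<open>a = 1\<close> the claim
    is \<open>2 * b - 1 \<le> b * b\<close>.\<close>
  have v_le: "v \<le> (a * b) * (a * b)"
  proof (cases "a = 1")
    case True
    have "0 \<le> (b - 1) * (b - 1)" by simp
    then show ?thesis using True by (simp add: v_def algebra_simps)
  next
    case False
    then have "2 * (a * b) \<le> (a * b) * (a * b)"
      using a b ab mult_mono[of 2 a 1 b] by (intro mult_right_mono) auto
    then show ?thesis unfolding v_def using ab(3) a by linarith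
  qed
  have "b \<le> v" using ab(3) v(1) by linarith
  then have b_le: "b * b \<le> v * v" using b v(2) by (intro mult_mono) auto
  have vv: "(a * b) * (a * b) \<le> v * v" using v(1,2) ab(4) by (intro mult_mono) auto
  have v1: "v * v + a * v = (a * b) * (a * b) + a * (b * b) + b * (a + 1) * (b - a)"
    by (simp add: v_def algebra_simps)
  have big: "((a * b) * (a * b)) ^ k + a * (b * b) ^ k \<le> (v * v) ^ k + a * v ^ k"
  proof (cases "b * b \<le> v")
    case True
    then have "(b * b) ^ k \<le> v ^ k" by (intro power_mono) auto
    moreover have "((a * b) * (a * b)) ^ k \<le> (v * v) ^ k" using vv by (intro power_mono) auto
    ultimately show ?thesis using a by (simp add: add_mono)
  next
    case False
    have base: "a * (b * b - v) \<le> v * v - (a * b) * (a * b)"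
    proof -
      have "0 \<le> b * (a + 1) * (b - a)" using a b assms by simp
      then show ?thesis using v1 by (simp add: right_diff_distrib)
    qed
    \<comment> \<open>Both sides are split by \<open>P ^ Suc j - Q ^ Suc j = P * (P ^ j - Q ^ j) + Q
      ^ j * (P - Q)\<close>. On the right \<open>P\<close> and \<open>Q\<close> are larger, by
      \<open>b_le\<close> and \<open>v_le\<close>, and \<open>base\<close> compares the differences
      \<open>P - Q\<close>; \<open>b * b > v\<close> keeps the differences on the left
      nonnegative.\<close>
    have "a * ((b * b) ^ j - v ^ j) \<le> (v * v) ^ j - ((a * b) * (a * b)) ^ j" for j
    proof (induction j)
      case (Suc j)
      have d: "0 \<le> (b * b) ^ j - v ^ j" using False v by (simp add: power_mono)
      have "a * ((b * b) ^ Suc j - v ^ Suc j) = (b * b) * (a * ((b * b) ^ j - v ^ j)) + v ^ j * (a * (b * b - v))"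
        by (simp add: algebra_simps)
      also have "\<dots> \<le> (v * v) * (a * ((b * b) ^ j - v ^ j)) + ((a * b) * (a * b)) ^ j * (a * (b * b - v))"
        using b_le d a v v_le False by (intro add_mono mult_right_mono power_mono) auto
      also have "\<dots> \<le> (v * v) * ((v * v) ^ j - ((a * b) * (a * b)) ^ j)
          + ((a * b) * (a * b)) ^ j * (v * v - (a * b) * (a * b))"
        using base Suc.IH by (intro add_mono mult_left_mono) auto
      also have "\<dots> = (v * v) ^ Suc j - ((a * b) * (a * b)) ^ Suc j"
        by (simp add: algebra_simps)
      finally show ?case .
    qed simp
    from this[of k] show ?thesis by (simp add: algebra_simps)
  qed
  \<comment> \<open>Equality holds at \<open>j = 0\<close>. Each further factor on the left is
    \<open>a * a \<le> v\<close> or 1, against \<open>v\<close> on the right.\<close>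
  have "b * (a * a) ^ Suc j + (a * b - a * a) \<le> a * v ^ Suc j" for j
  proof (induction j)
    case 0
    then show ?case by (simp add: v_def algebra_simps)
  next
    case (Suc j)
    have "b * (a * a) ^ Suc (Suc j) + (a * b - a * a) = (a * a) * (b * (a * a) ^ Suc j) + 1 * (a * b - a * a)"
      by (simp add: algebra_simps)
    also have "\<dots> \<le> v * (b * (a * a) ^ Suc j) + v * (a * b - a * a)"
      using v(2,3) ab(1) b by (intro add_mono mult_right_mono) auto
    also have "\<dots> = v * (b * (a * a) ^ Suc j + (a * b - a * a))" by (simp add: algebra_simps)
    also have "\<dots> \<le> v * (a * v ^ Suc j)" using Suc v by (intro mult_left_mono) auto
    also have "\<dots> = a * v ^ Suc (Suc j)" by simp
    finally show ?case .
  qed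
  from this[of "k - 1"] have small: "b * (a * a) ^ k + (a * b - a * a) \<le> a * v ^ k"
    using assms(3) by simp
  have "((a * a) ^ k + a) * ((b * b) ^ k + b)
    = (((a * b) * (a * b)) ^ k + a * (b * b) ^ k) + (b * (a * a) ^ k + (a * b - a * a)) + a * a"
    by (simp add: algebra_simps power_mult_distrib)
  also have "\<dots> \<le> ((v * v) ^ k + a * v ^ k) + a * v ^ k + a * a"
    by (intro add_mono big small order_refl)
  also have "\<dots> = (v ^ k + a) ^ 2"
    by (simp add: algebra_simps power_mult_distrib power2_eq_square)
  finally show ?thesis by (simp add: v_def)
qed

lemma list_swappable_cycle_graph:
  assumes "0 < k"
  shows "list_swappable (cycle_graph (2 * k))"
proof (rule list_swappable_if_nested[OF wf_cycle_graph])
  show "2 \<le> 2 * k" using assms by simp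
  fix X Y :: "nat set" assume Y: "finite Y" "X \<subseteq> Y"
  let ?H = "cycle_graph (2 * k)"
  have X: "finite X" using Y finite_subset by blast
  show "card (colourings ?H X) * card (colourings ?H Y) \<le> card (cover_colourings ?H X Y)"
  proof (cases "X = {}")
    \<comment> \<open>Treated apart, since the counting inequality needs \<open>card X - 1\<close>
      to be nonnegative.\<close>
    case True
    then have "verts ?H \<rightarrow>\<^sub>E X = {}"
      using assms by (auto simp: cycle_graph_def PiE_eq_empty_iff intro!: exI[of _ 0])
    then have "colourings ?H X = {}" by (simp add: colourings_def)
    then show ?thesis by simp
  next
    case False
    \<comment> \<open>With these shifts the eigenvalue \<open>1 + x (y - 2)\<close> becomes
      \<open>a * b + b - a\<close>, and \<open>a * a\<close> or \<open>b * b\<close> when both lists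
      are equal.\<close>
    define a b where "a = int (card X) - 1" and "b = int (card Y) - 1"
    have "0 < card X" "card X \<le> card Y" using False X Y by (auto simp: card_gt_0_iff card_mono)
    then have ab: "0 \<le> a" "a \<le> b" by (auto simp: a_def b_def)
    have P: "int (card (colourings ?H X)) = (a * a) ^ k + a" "int (card (colourings ?H Y)) = (b * b) ^ k + b"
      unfolding colourings_cycle_graph card_closed_walks_alternating[OF X order_refl assms]
        card_closed_walks_alternating[OF Y(1) order_refl assms]
      by (simp_all add: a_def b_def algebra_simps)
    have Z: "int (card (closed_walks (alternating X Y) (2 * k))) = (a * b + b - a) ^ k + a"
      unfolding card_closed_walks_alternating[OF Y assms]
      by (simp add: a_def b_def algebra_simps)
    have "int (card (colourings ?H X) * card (colourings ?H Y))
      \<le> int (card (closed_walks (alternating X Y) (2 * k)) ^ 2)"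
      using cycle_count_inequality[OF ab assms] by (simp only: of_nat_mult of_nat_power P Z)
    then have "card (colourings ?H X) * card (colourings ?H Y) \<le> card (closed_walks (alternating X Y) (2 * k)) ^ 2"
      by (simp only: of_nat_le_iff)
    also have "\<dots> \<le> card (cover_colourings ?H X Y)"
      using X Y assms by (intro cover_colourings_cycle_graph_ge) auto
    finally show ?thesis .
  qed
qed

lemma list_swappable_even_cycle:
  assumes "is_even_cycle H"
  shows "list_swappable H"
proof -
  obtain n :: nat and p where "n \<ge> 4" "even n" and p: "bij_betw p {0..<n} (verts H)"
    and E: "edges H = {(p i, p j) | i j. i < n \<and> j < n \<and> (j = (i + 1) mod n \<or> i = (j + 1) mod n)}"
    using assms unfolding is_even_cycle_def by blast
  then obtain k where k: "n = 2 * k" "0 < k" by (elim evenE) auto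
  show ?thesis
    by (rule list_swappable_isomorphic[OF _ _ wf_cycle_graph list_swappable_cycle_graph[OF k(2)]])
      (use p E k in \<open>auto simp: cycle_graph_def\<close>)
qed

subsection \<open>Blow-ups of bipartite graphs\<close>

lemma card_le_by_fibres:
  assumes "finite S" "finite T"
    and "\<And>s. s \<in> S \<Longrightarrow> card {s' \<in> S. \<rho> s' = \<rho> s} \<le> card {t \<in> T. \<rho> t = \<rho> s}"
  shows "card S \<le> card T"
proof -
  have "card S = (\<Sum>r\<in>\<rho> ` S. card {s \<in> S. \<rho> s = r})"
    using sum.image_gen[OF assms(1), of "\<lambda>_. 1::nat" \<rho>] by simp
  also have "\<dots> \<le> (\<Sum>r\<in>\<rho> ` S. card {t \<in> T. \<rho> t = r})"
    using assms(3) by (intro sum_mono) auto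
  also have "\<dots> = card (\<Union>r\<in>\<rho> ` S. {t \<in> T. \<rho> t = r})"
    using assms(1,2) by (subst card_UN_disjoint) auto
  also have "\<dots> \<le> card T" using assms(2) by (intro card_mono) auto
  finally show ?thesis .
qed

text \<open>Interpolates between pairs of proper colourings (\<open>U = {}\<close>) and, after the bipartite swap,
  colourings of the double cover (\<open>U = verts F\<close>).\<close>
definition mixed_colourings ::
    "'b graph \<Rightarrow> ('b \<Rightarrow> 'a graph) \<Rightarrow> 'c set \<Rightarrow> 'b set \<Rightarrow> (('b \<times> 'a \<Rightarrow> 'c) \<times> ('b \<times> 'a \<Rightarrow> 'c)) set" where
  "mixed_colourings F Hs C U = {(f, g).
     f \<in> Sigma (verts F) (\<lambda>i. verts (Hs i)) \<rightarrow>\<^sub>E C \<and> g \<in> Sigma (verts F) (\<lambda>i. verts (Hs i)) \<rightarrow>\<^sub>E C \<and>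
     (\<forall>i j x y. (i, j) \<in> edges F \<longrightarrow> x \<in> verts (Hs i) \<longrightarrow> y \<in> verts (Hs j) \<longrightarrow>
        f (i, x) \<noteq> f (j, y) \<and> g (i, x) \<noteq> g (j, y)) \<and>
     (\<forall>i \<in> verts F - U. \<forall>(x, y) \<in> edges (Hs i). f (i, x) \<noteq> f (i, y) \<and> g (i, x) \<noteq> g (i, y)) \<and>
     (\<forall>i \<in> verts F \<inter> U. \<forall>(x, y) \<in> edges (Hs i). f (i, x) \<noteq> g (i, y))}"

lemma finite_mixed_colourings:
  assumes "finite (verts F)" "\<And>i. i \<in> verts F \<Longrightarrow> finite (verts (Hs i))" "finite C"
  shows "finite (mixed_colourings F Hs C U)"
proof (rule finite_subset)
  let ?V = "Sigma (verts F) (\<lambda>i. verts (Hs i))"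
  show "mixed_colourings F Hs C U \<subseteq> (?V \<rightarrow>\<^sub>E C) \<times> (?V \<rightarrow>\<^sub>E C)"
    by (auto simp: mixed_colourings_def)
  show "finite ((?V \<rightarrow>\<^sub>E C) \<times> (?V \<rightarrow>\<^sub>E C))"
    using assms by (auto intro!: finite_PiE)
qed

text \<open>The fibres of restriction to the other blobs are compared. Over a fixed pair outside
  blob \<open>k\<close>, the conditions left are those of the two list-colouring problems that
  \<open>list_swappable\<close> relates.\<close>

lemma mixed_colourings_insert:
  fixes C :: "nat set"
  assumes wf: "wf_graph F" and wfH: "\<And>i. i \<in> verts F \<Longrightarrow> wf_graph (Hs i)" and C: "finite C"
    and k: "k \<in> verts F" "k \<notin> U" and swap: "list_swappable (Hs k)"
  shows "card (mixed_colourings F Hs C U) \<le> card (mixed_colourings F Hs C (insert k U))"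
proof -
  let ?V = "Sigma (verts F) (\<lambda>i. verts (Hs i))"
  let ?R = "?V - {k} \<times> verts (Hs k)"
  let ?\<rho> = "map_prod (\<lambda>f. restrict f ?R) (\<lambda>f. restrict f ?R) ::
    ('a \<times> 'b \<Rightarrow> nat) \<times> ('a \<times> 'b \<Rightarrow> nat) \<Rightarrow> ('a \<times> 'b \<Rightarrow> nat) \<times> ('a \<times> 'b \<Rightarrow> nat)"
  have irr: "(i, i) \<notin> edges F" for i using wf by (auto simp: wf_graph_def irrefl_def)
  have symF: "(j, i) \<in> edges F" if "(i, j) \<in> edges F" for i j
    using wf that by (auto simp: wf_graph_def sym_def)
  have subF: "i \<in> verts F" "j \<in> verts F" if "(i, j) \<in> edges F" for i j
    using wf that by (auto simp: wf_graph_def)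
  have subH: "x \<in> verts (Hs i)" "y \<in> verts (Hs i)" if "i \<in> verts F" "(x, y) \<in> edges (Hs i)" for i x y
    using wfH that by (fastforce simp: wf_graph_def)+
  have fin: "finite (mixed_colourings F Hs C U')" for U'
    using wf wfH C by (intro finite_mixed_colourings) (auto simp: wf_graph_def)
  have finHk: "finite (verts (Hs k))" using wfH k by (auto simp: wf_graph_def)
  show ?thesis
  proof (rule card_le_by_fibres[where \<rho> = ?\<rho>, OF fin fin])
    fix s assume "s \<in> mixed_colourings F Hs C U"
    then obtain f0 g0 where s: "s = (f0, g0)" and fg0: "(f0, g0) \<in> mixed_colourings F Hs C U"
      by (cases s) auto
    \<comment> \<open>The list for blob \<open>k\<close>: colours absent from all adjacent blobs. As
      \<open>F\<close> has no loops, it does not depend on the colours inside blob \<open>k\<close>,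
      so it is constant on a fibre.\<close>
    define free where "free f = C - {f (j, y) | j y. (k, j) \<in> edges F \<and> y \<in> verts (Hs j)}"
      for f :: "'a \<times> 'b \<Rightarrow> nat"
    let ?A = "{s' \<in> mixed_colourings F Hs C U. ?\<rho> s' = ?\<rho> s}"
    let ?B = "{t \<in> mixed_colourings F Hs C (insert k U). ?\<rho> t = ?\<rho> s}"
    have agree: "f (i, x) = f' (i, x)"
      if "restrict f ?R = restrict f' ?R" "i \<in> verts F" "x \<in> verts (Hs i)" "i \<noteq> k" for f f' :: "'a \<times> 'b \<Rightarrow> nat" and i x
      using fun_cong[OF that(1), of "(i, x)"] that(2-) by auto
    have freecong: "free f = free f'" if "restrict f ?R = restrict f' ?R" for f f'
    proof -
      have "f (j, y) = f' (j, y)" if "(k, j) \<in> edges F" "y \<in> verts (Hs j)" for j y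
        using agree[OF \<open>restrict f ?R = restrict f' ?R\<close>, of j y] that subF irr by metis
      then show ?thesis by (auto simp: free_def) metis+
    qed
    have finfree: "finite (free f)" for f using C by (auto simp: free_def)
    let ?m = "\<lambda>f. \<lambda>x\<in>verts (Hs k). f (k, x)"
    have col: "?m f \<in> colourings (Hs k) (free f)"
      if f: "f \<in> ?V \<rightarrow>\<^sub>E C"
        and x: "\<And>i j x y. (i, j) \<in> edges F \<Longrightarrow> x \<in> verts (Hs i) \<Longrightarrow> y \<in> verts (Hs j) \<Longrightarrow> f (i, x) \<noteq> f (j, y)"
        and p: "\<And>x y. (x, y) \<in> edges (Hs k) \<Longrightarrow> f (k, x) \<noteq> f (k, y)" for f
    proof -
      have "f (k, x) \<in> free f" if "x \<in> verts (Hs k)" for x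
        using that x f k by (auto simp: free_def PiE_iff)
      then show ?thesis using p subH[OF k(1)] by (auto simp: colourings_def)
    qed
    have "card ?A \<le> card (colourings (Hs k) (free f0) \<times> colourings (Hs k) (free g0))"
    proof (rule card_inj_on_le[where f = "map_prod ?m ?m"])
      have ext: "f = f'" if "f \<in> ?V \<rightarrow>\<^sub>E C" "f' \<in> ?V \<rightarrow>\<^sub>E C" "restrict f ?R = restrict f' ?R" "?m f = ?m f'" for f f'
      proof (rule PiE_ext[OF that(1,2)])
        fix v assume v: "v \<in> ?V"
        show "f v = f' v"
        proof (cases "v \<in> ?R")
          case True
          then show ?thesis using fun_cong[OF that(3), of v] by simp
        next
          case False
          then obtain x where "v = (k, x)" "x \<in> verts (Hs k)" using v by auto
          then show ?thesis using fun_cong[OF that(4), of x] by simp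
        qed
      qed
      show "inj_on (map_prod ?m ?m) ?A"
      proof (rule inj_onI)
        fix a b assume ab: "a \<in> ?A" "b \<in> ?A" and e: "map_prod ?m ?m a = map_prod ?m ?m b"
        obtain f g f' g' where a: "a = (f, g)" and b: "b = (f', g')" by (cases a, cases b) auto
        have r: "restrict f ?R = restrict f' ?R" "restrict g ?R = restrict g' ?R"
          using ab unfolding a b s by auto
        have m: "f \<in> ?V \<rightarrow>\<^sub>E C" "f' \<in> ?V \<rightarrow>\<^sub>E C" "g \<in> ?V \<rightarrow>\<^sub>E C" "g' \<in> ?V \<rightarrow>\<^sub>E C"
          using ab unfolding a b by (auto simp: mixed_colourings_def)
        have "?m f = ?m f'" "?m g = ?m g'" using e unfolding a b by auto
        then show "a = b" unfolding a b using ext r m by blast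
      qed
      show "map_prod ?m ?m ` ?A \<subseteq> colourings (Hs k) (free f0) \<times> colourings (Hs k) (free g0)"
      proof (rule image_subsetI)
        fix a assume a: "a \<in> ?A"
        obtain f g where fg: "a = (f, g)" by (cases a)
        have mem: "(f, g) \<in> mixed_colourings F Hs C U" and
          r: "restrict f ?R = restrict f0 ?R" "restrict g ?R = restrict g0 ?R"
          using a unfolding fg s by auto
        have "?m f \<in> colourings (Hs k) (free f)"
          by (rule col) (use mem k in \<open>auto simp: mixed_colourings_def\<close>)
        moreover have "?m g \<in> colourings (Hs k) (free g)"
          by (rule col) (use mem k in \<open>auto simp: mixed_colourings_def\<close>)
        ultimately show "map_prod ?m ?m a \<in> colourings (Hs k) (free f0) \<times> colourings (Hs k) (free g0)"
          using freecong[OF r(1)] freecong[OF r(2)] by (simp add: fg)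
      qed
      show "finite (colourings (Hs k) (free f0) \<times> colourings (Hs k) (free g0))"
        by (simp add: finite_colourings finHk finfree)
    qed
    also have "\<dots> \<le> card (cover_colourings (Hs k) (free f0) (free g0))"
      using swap finfree by (auto simp: list_swappable_def card_cartesian_product)
    \<comment> \<open>Conversely, any colouring of the double cover of blob \<open>k\<close> from
      these lists can be written over \<open>f0\<close> and \<open>g0\<close> on that blob.\<close>
    also have "\<dots> \<le> card ?B"
    proof (rule card_inj_on_le)
      let ?e = "\<lambda>f0 a (i, x). if i = k \<and> x \<in> verts (Hs k) then a x else f0 (i, x)"
      have inj: "a = a'" if "a \<in> verts (Hs k) \<rightarrow>\<^sub>E Z" "a' \<in> verts (Hs k) \<rightarrow>\<^sub>E Z" "?e f a = ?e f a'"
        for a a' Z and f :: "'a \<times> 'b \<Rightarrow> nat"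
      proof (rule PiE_ext[OF that(1,2)])
        fix v assume "v \<in> verts (Hs k)"
        then show "a v = a' v" using fun_cong[OF that(3), of "(k, v)"] by simp
      qed
      show "inj_on (map_prod (?e f0) (?e g0)) (cover_colourings (Hs k) (free f0) (free g0))"
      proof (rule inj_onI)
        fix u w assume uw: "u \<in> cover_colourings (Hs k) (free f0) (free g0)"
          "w \<in> cover_colourings (Hs k) (free f0) (free g0)"
          and e: "map_prod (?e f0) (?e g0) u = map_prod (?e f0) (?e g0) w"
        obtain a b a' b' where u: "u = (a, b)" and w: "w = (a', b')" by (cases u, cases w) auto
        have "?e f0 a = ?e f0 a'" "?e g0 b = ?e g0 b'" using e unfolding u w by auto
        moreover have "a \<in> verts (Hs k) \<rightarrow>\<^sub>E free f0" "a' \<in> verts (Hs k) \<rightarrow>\<^sub>E free f0"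
          "b \<in> verts (Hs k) \<rightarrow>\<^sub>E free g0" "b' \<in> verts (Hs k) \<rightarrow>\<^sub>E free g0"
          using uw unfolding u w by (auto simp: cover_colourings_def)
        ultimately show "u = w" unfolding u w using inj by blast
      qed
      have ext_mem: "?e f a \<in> ?V \<rightarrow>\<^sub>E C"
        if "f \<in> ?V \<rightarrow>\<^sub>E C" "a \<in> verts (Hs k) \<rightarrow>\<^sub>E free f" for f a
      proof (rule PiE_I)
        fix v assume "v \<in> ?V"
        then show "?e f a v \<in> C"
          using that by (cases v) (auto simp: PiE_iff free_def)
      next
        fix v assume "v \<notin> ?V"
        then show "?e f a v = undefined"
          using that k by (cases v) (auto simp: PiE_iff extensional_def)
      qed
      have restr: "restrict (?e f a) ?R = restrict f ?R" for f :: "'a \<times> 'b \<Rightarrow> nat" and a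
        by (rule ext) (auto simp: restrict_apply split: if_splits)
      have cross: "?e f a (i, x) \<noteq> ?e f a (j, y)"
        if ij: "(i, j) \<in> edges F" "x \<in> verts (Hs i)" "y \<in> verts (Hs j)"
          and a: "a \<in> verts (Hs k) \<rightarrow>\<^sub>E free f" and ne: "f (i, x) \<noteq> f (j, y)" for f a i j x y
      proof -
        have "a x \<noteq> f (j, y)" if "i = k" "x \<in> verts (Hs k)"
          using a that ij by (auto simp: free_def PiE_iff)
        moreover have "f (i, x) \<noteq> a y" if "j = k" "y \<in> verts (Hs k)"
          using a that ij symF by (fastforce simp: free_def PiE_iff)
        moreover have "i \<noteq> j" using ij irr by auto
        ultimately show ?thesis using ij ne by auto
      qed
      show "map_prod (?e f0) (?e g0) ` cover_colourings (Hs k) (free f0) (free g0) \<subseteq> ?B"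
      proof (rule image_subsetI)
        fix u assume u: "u \<in> cover_colourings (Hs k) (free f0) (free g0)"
        obtain a b where ab: "u = (a, b)" by (cases u)
        have a: "a \<in> verts (Hs k) \<rightarrow>\<^sub>E free f0" and b: "b \<in> verts (Hs k) \<rightarrow>\<^sub>E free g0"
          and e: "\<And>x y. (x, y) \<in> edges (Hs k) \<Longrightarrow> a x \<noteq> b y"
          using u unfolding ab by (auto simp: cover_colourings_def)
        have f0: "f0 \<in> ?V \<rightarrow>\<^sub>E C" and g0: "g0 \<in> ?V \<rightarrow>\<^sub>E C"
          and c0: "\<And>i j x y. (i, j) \<in> edges F \<Longrightarrow> x \<in> verts (Hs i) \<Longrightarrow> y \<in> verts (Hs j) \<Longrightarrow>
            f0 (i, x) \<noteq> f0 (j, y) \<and> g0 (i, x) \<noteq> g0 (j, y)"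
          and n0: "\<And>i x y. i \<in> verts F - U \<Longrightarrow> (x, y) \<in> edges (Hs i) \<Longrightarrow>
            f0 (i, x) \<noteq> f0 (i, y) \<and> g0 (i, x) \<noteq> g0 (i, y)"
          and u0: "\<And>i x y. i \<in> verts F \<inter> U \<Longrightarrow> (x, y) \<in> edges (Hs i) \<Longrightarrow> f0 (i, x) \<noteq> g0 (i, y)"
          using fg0 by (fastforce simp: mixed_colourings_def)+
        have "(?e f0 a, ?e g0 b) \<in> mixed_colourings F Hs C (insert k U)"
          unfolding mixed_colourings_def mem_Collect_eq prod.case
        proof (intro conjI)
          show "\<forall>i j x y. (i, j) \<in> edges F \<longrightarrow> x \<in> verts (Hs i) \<longrightarrow> y \<in> verts (Hs j) \<longrightarrow>
             (if i = k \<and> x \<in> verts (Hs k) then a x else f0 (i, x)) \<noteq>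
             (if j = k \<and> y \<in> verts (Hs k) then a y else f0 (j, y)) \<and>
             (if i = k \<and> x \<in> verts (Hs k) then b x else g0 (i, x)) \<noteq>
             (if j = k \<and> y \<in> verts (Hs k) then b y else g0 (j, y))"
            using cross[OF _ _ _ a] cross[OF _ _ _ b] c0
            by (intro allI impI) (simp only: prod.case simp_thms)
          show "\<forall>i\<in>verts F - insert k U. \<forall>(x, y)\<in>edges (Hs i).
             (if i = k \<and> x \<in> verts (Hs k) then a x else f0 (i, x)) \<noteq>
             (if i = k \<and> y \<in> verts (Hs k) then a y else f0 (i, y)) \<and>
             (if i = k \<and> x \<in> verts (Hs k) then b x else g0 (i, x)) \<noteq>
             (if i = k \<and> y \<in> verts (Hs k) then b y else g0 (i, y))"
            using n0 by auto
          show "\<forall>i\<in>verts F \<inter> insert k U. \<forall>(x, y)\<in>edges (Hs i).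
             (if i = k \<and> x \<in> verts (Hs k) then a x else f0 (i, x)) \<noteq>
             (if i = k \<and> y \<in> verts (Hs k) then b y else g0 (i, y))"
            using u0 e subH k by (auto split: if_splits)
        qed (use ext_mem a b f0 g0 in auto)
        then show "map_prod (?e f0) (?e g0) u \<in> ?B"
          using restr by (simp add: ab s)
      qed
      show "finite ?B" using fin by simp
    qed
    finally show "card ?A \<le> card ?B" .
  qed
qed

section \<open>The two ends of the interpolation as homomorphism counts\<close>

lemma hom_complete_graph:
  assumes "edges H \<subseteq> verts H \<times> verts H"
  shows "hom H (complete_graph q) = card (colourings H {0..<q})"
proof -
  have "(f u, f v) \<in> edges (complete_graph q) \<longleftrightarrow> f u \<noteq> f v"
    if "f \<in> verts H \<rightarrow>\<^sub>E {0..<q}" "(u, v) \<in> edges H" for f u v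
    using that assms by (fastforce simp: complete_graph_def PiE_iff)
  moreover have "verts (complete_graph q) = {0..<q}" by (simp add: complete_graph_def)
  ultimately have "{f. f \<in> verts H \<rightarrow>\<^sub>E verts (complete_graph q) \<and>
      (\<forall>(u, v) \<in> edges H. (f u, f v) \<in> edges (complete_graph q))} = colourings H {0..<q}"
    unfolding colourings_def by (intro Collect_cong conj_cong ball_cong) auto
  then show ?thesis by (simp add: hom_def)
qed

text \<open>With no blob converted, nothing links \<open>f\<close> to \<open>g\<close>, and each of
  them is a proper colouring of the blow-up.\<close>

lemma hom_square_eq_mixed_colourings:
  assumes "wf_graph F" "\<And>i. i \<in> verts F \<Longrightarrow> wf_graph (Hs i)"
  shows "hom (blow_up F Hs) (complete_graph q) ^ 2 = card (mixed_colourings F Hs {0..<q} {})"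
proof -
  have subF: "i \<in> verts F" "j \<in> verts F" if "(i, j) \<in> edges F" for i j
    using assms(1) that by (auto simp: wf_graph_def)
  have subH: "x \<in> verts (Hs i)" "y \<in> verts (Hs i)" if "i \<in> verts F" "(x, y) \<in> edges (Hs i)" for i x y
    using assms(2) that by (fastforce simp: wf_graph_def)+
  have "mixed_colourings F Hs {0..<q} {} = colourings (blow_up F Hs) {0..<q} \<times> colourings (blow_up F Hs) {0..<q}"
    (is "?L = ?R")
  proof (intro equalityI subsetI)
    fix w assume "w \<in> ?L"
    then show "w \<in> ?R"
      by (cases w) (fastforce simp: mixed_colourings_def colourings_def blow_up_def)
  next
    fix w assume w: "w \<in> ?R"
    obtain f g where fg: "w = (f, g)" by (cases w)
    have *: "f u \<noteq> f v \<and> g u \<noteq> g v" if "(u, v) \<in> edges (blow_up F Hs)" for u v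
      using w that unfolding fg by (auto simp: colourings_def)
    have "f (i, x) \<noteq> f (j, y) \<and> g (i, x) \<noteq> g (j, y)"
      if "(i, j) \<in> edges F" "x \<in> verts (Hs i)" "y \<in> verts (Hs j)" for i j x y
      using that subF[OF that(1)] by (intro *) (auto simp: blow_up_def)
    moreover have "f (i, x) \<noteq> f (i, y) \<and> g (i, x) \<noteq> g (i, y)"
      if "i \<in> verts F" "(x, y) \<in> edges (Hs i)" for i x y
      using that subH[OF that] by (intro *) (auto simp: blow_up_def)
    moreover have "f \<in> Sigma (verts F) (\<lambda>i. verts (Hs i)) \<rightarrow>\<^sub>E {0..<q}"
      "g \<in> Sigma (verts F) (\<lambda>i. verts (Hs i)) \<rightarrow>\<^sub>E {0..<q}"
      using w unfolding fg by (auto simp: colourings_def blow_up_def)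
    ultimately show "w \<in> ?L" by (auto simp: mixed_colourings_def fg)
  qed
  moreover have "edges (blow_up F Hs) \<subseteq> verts (blow_up F Hs) \<times> verts (blow_up F Hs)"
    by (auto simp: blow_up_def)
  ultimately show ?thesis
    by (simp add: hom_complete_graph card_cartesian_product power2_eq_square)
qed

text \<open>\<open>f\<close> is put on copy 1 of the blobs with \<open>c\<close> true and on copy 2
  of the others, \<open>g\<close> on the remaining places. An edge between blobs changes both the
  side and the copy, so it stays within \<open>f\<close> or within \<open>g\<close>; an edge inside
  a blob changes only the copy and joins \<open>f\<close> to \<open>g\<close>.\<close>

lemma mixed_colourings_le_hom_tensor_K2:
  assumes "wf_graph F" "\<And>i. i \<in> verts F \<Longrightarrow> wf_graph (Hs i)" "bipartite F"
  shows "card (mixed_colourings F Hs {0..<q} (verts F)) \<le> hom (tensor_K2 (blow_up F Hs)) (complete_graph q)"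
proof -
  obtain c :: "'a \<Rightarrow> bool" where "\<forall>(i, j) \<in> edges F. c i \<noteq> c j"
    using assms(3) unfolding bipartite_def by (rule exE)
  then have c: "c i \<noteq> c j" if "(i, j) \<in> edges F" for i j
    using that by auto
  let ?V = "Sigma (verts F) (\<lambda>i. verts (Hs i))"
  let ?T = "tensor_K2 (blow_up F Hs)"
  have symH: "(y, x) \<in> edges (Hs i)" if "i \<in> verts F" "(x, y) \<in> edges (Hs i)" for i x y
    using assms(2) that by (auto simp: wf_graph_def sym_def)
  have VT: "verts ?T = ?V \<times> {1, 2}" by (simp add: tensor_K2_def blow_up_def)
  have "edges ?T \<subseteq> verts ?T \<times> verts ?T" by (auto simp: tensor_K2_def blow_up_def)
  then have hom: "hom ?T (complete_graph q) = card (colourings ?T {0..<q})"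
    by (rule hom_complete_graph)
  let ?m = "\<lambda>(f, g). \<lambda>(v, n) \<in> ?V \<times> {1, 2 :: nat}. if c (fst v) = (n = 1) then f v else g v :: nat"
  have m: "?m (f, g) (v, n) = (if c (fst v) = (n = 1) then f v else g v)" if "v \<in> ?V" "n \<in> {1, 2}" for f g v n
    using that by simp
  have "card (mixed_colourings F Hs {0..<q} (verts F)) \<le> card (colourings ?T {0..<q})"
  proof (rule card_inj_on_le)
    show "inj_on ?m (mixed_colourings F Hs {0..<q} (verts F))"
    proof (rule inj_onI)
      fix u w assume uw: "u \<in> mixed_colourings F Hs {0..<q} (verts F)" "w \<in> mixed_colourings F Hs {0..<q} (verts F)"
        and e: "?m u = ?m w"
      obtain f g f' g' where u: "u = (f, g)" and w: "w = (f', g')" by (cases u, cases w) auto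
      have f: "f \<in> ?V \<rightarrow>\<^sub>E {0..<q}" "f' \<in> ?V \<rightarrow>\<^sub>E {0..<q}" and g: "g \<in> ?V \<rightarrow>\<^sub>E {0..<q}" "g' \<in> ?V \<rightarrow>\<^sub>E {0..<q}"
        using uw unfolding u w by (auto simp: mixed_colourings_def)
      have fg: "f v = f' v \<and> g v = g' v" if v: "v \<in> ?V" for v
      proof -
        have "(if c (fst v) = (n = 1) then f v else g v) = (if c (fst v) = (n = 1) then f' v else g' v)"
          if n: "n \<in> {1, 2}" for n :: nat
          using fun_cong[OF e, of "(v, n)"] unfolding u w m[OF v n] .
        from this[of 1] this[of 2] show ?thesis by (cases "c (fst v)") auto
      qed
      have "f = f'" by (rule PiE_ext[OF f]) (use fg in blast)
      moreover have "g = g'" by (rule PiE_ext[OF g]) (use fg in blast)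
      ultimately show "u = w" by (simp add: u w)
    qed
    show "?m ` mixed_colourings F Hs {0..<q} (verts F) \<subseteq> colourings ?T {0..<q}"
    proof (rule image_subsetI)
      fix w assume w: "w \<in> mixed_colourings F Hs {0..<q} (verts F)"
      obtain f g where fg: "w = (f, g)" by (cases w)
      have mem: "f \<in> ?V \<rightarrow>\<^sub>E {0..<q}" "g \<in> ?V \<rightarrow>\<^sub>E {0..<q}"
        and cross: "\<And>i j x y. (i, j) \<in> edges F \<Longrightarrow> x \<in> verts (Hs i) \<Longrightarrow> y \<in> verts (Hs j) \<Longrightarrow>
            f (i, x) \<noteq> f (j, y) \<and> g (i, x) \<noteq> g (j, y)"
        and ins: "\<And>i x y. i \<in> verts F \<Longrightarrow> (x, y) \<in> edges (Hs i) \<Longrightarrow> f (i, x) \<noteq> g (i, y)"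
        using w unfolding fg by (fastforce simp: mixed_colourings_def)+
      have "?m (f, g) \<in> verts ?T \<rightarrow>\<^sub>E {0..<q}"
        unfolding VT using mem by (auto simp: PiE_iff)
      moreover have "?m (f, g) a \<noteq> ?m (f, g) b" if ab: "(a, b) \<in> edges ?T" for a b
      proof -
        obtain i x n j y n' where a: "a = ((i, x), n)" and b: "b = ((j, y), n')" by (cases a, cases b) auto
        have ij: "i \<in> verts F" "j \<in> verts F" "x \<in> verts (Hs i)" "y \<in> verts (Hs j)"
          "n \<in> {1, 2}" "n' \<in> {1, 2}" "n \<noteq> n'" and
          E: "i = j \<and> (x, y) \<in> edges (Hs i) \<or> (i, j) \<in> edges F"
          using ab by (auto simp: a b tensor_K2_def blow_up_def)
        have V: "(i, x) \<in> ?V" "(j, y) \<in> ?V" using ij by auto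
        have n: "(n' = 1) \<longleftrightarrow> \<not> n = 1" using ij by auto
        show ?thesis unfolding a b m[OF V(1) ij(5)] m[OF V(2) ij(6)] n
          using E
        proof
          \<comment> \<open>If \<open>(i, x)\<close> receives its colour from \<open>g\<close>, the
            condition is applied to the reversed edge \<open>(y, x)\<close>; hence the symmetry of
            \<open>edges (Hs i)\<close>.\<close>
          assume "i = j \<and> (x, y) \<in> edges (Hs i)"
          then show "(if c (fst (i, x)) = (n = 1) then f (i, x) else g (i, x)) \<noteq>
            (if c (fst (j, y)) = (n \<noteq> 1) then f (j, y) else g (j, y))"
            using ins[of i x y] ins[of i y x] symH[of i x y] ij by (auto split: if_splits)
        next
          assume "(i, j) \<in> edges F"
          then show "(if c (fst (i, x)) = (n = 1) then f (i, x) else g (i, x)) \<noteq>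
            (if c (fst (j, y)) = (n \<noteq> 1) then f (j, y) else g (j, y))"
            using cross[of i j x y] c[of i j] ij by (auto split: if_splits)
        qed
      qed
      ultimately show "?m w \<in> colourings ?T {0..<q}"
        unfolding colourings_def fg by blast
    qed
    have "finite ?V" using assms by (auto simp: wf_graph_def)
    then show "finite (colourings ?T {0..<q})" by (intro finite_colourings) (auto simp: VT)
  qed
  then show ?thesis by (simp add: hom)
qed

text \<open>Blobs are converted one at a time, in any order; of each blob only
  \<open>list_swappable\<close> and well-formedness are required.\<close>

lemma blow_up_swappable:
  assumes wf: "wf_graph F" and "bipartite F" and wfH: "\<And>i. i \<in> verts F \<Longrightarrow> wf_graph (Hs i)"
    and swap: "\<And>i. i \<in> verts F \<Longrightarrow> list_swappable (Hs i)"
  shows "hom (blow_up F Hs) (complete_graph q) ^ 2 \<le> hom (tensor_K2 (blow_up F Hs)) (complete_graph q)"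
proof -
  have "card (mixed_colourings F Hs {0..<q} {}) \<le> card (mixed_colourings F Hs {0..<q} U)"
    if "finite U" "U \<subseteq> verts F" for U
    using that
  proof induction
    case (insert k U)
    then have "card (mixed_colourings F Hs {0..<q} {}) \<le> card (mixed_colourings F Hs {0..<q} U)" by simp
    also have "\<dots> \<le> card (mixed_colourings F Hs {0..<q} (insert k U))"
      using insert by (intro mixed_colourings_insert wf wfH swap) auto
    finally show ?case .
  qed simp
  from this[of "verts F"]
  have "card (mixed_colourings F Hs {0..<q} {}) \<le> card (mixed_colourings F Hs {0..<q} (verts F))"
    using wf by (simp add: wf_graph_def)
  also have "\<dots> \<le> hom (tensor_K2 (blow_up F Hs)) (complete_graph q)"
    using assms by (intro mixed_colourings_le_hom_tensor_K2) auto
  finally show ?thesis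
    using assms by (simp add: hom_square_eq_mixed_colourings)
qed

theorem theorem1p4:
  fixes F :: "'b graph" and Hs :: "'b \<Rightarrow> 'a graph" and q :: nat
  assumes "wf_graph F" and "bipartite F"
    and "\<And>v. v \<in> verts F \<Longrightarrow> wf_graph (Hs v) \<and> class_H (Hs v)"
    and "q \<ge> 2"
  shows "hom (blow_up F Hs) (complete_graph q) ^ 2
           \<le> hom (tensor_K2 (blow_up F Hs)) (complete_graph q)"
proof (rule blow_up_swappable)
  fix i assume "i \<in> verts F"
  then show "list_swappable (Hs i)"
    using assms(3)[of i] list_swappable_complete_multipartite list_swappable_even_cycle list_swappable_path
    by (auto simp: class_H_def)
qed (use assms in auto)

end
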